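(* For every $4\times 4$ real symmetric positive definite matrix $A$, we have $R_2(A)\le 1$ and $R_3(A)\le 1$, where $$R_2(A)=\frac{\Delta_{1234}^2\,\Delta_{23}\,\Delta_{24}\,\Delta_{34}\,\Delta_{1}}{\Delta_{123}\,\Delta_{124}\,\Delta_{134}\,\Delta_{234}\,\Delta_{2}\,\Delta_{3}\,\Delta_{4}},\qquad R_3(A)=\frac{\Delta_{1234}\,\Delta_{23}\,\Delta_{24}\,\Delta_{34}\,\Delta_{1}^2}{\Delta_{234}\,\Delta_{12}\,\Delta_{13}\,\Delta_{14}\,\Delta_{2}\,\Delta_{3}\,\Delta_{4}}.$$
   Context: For a $4\times4$ matrix $A=(a_{ij})$ and a nonempty index set $\alpha\subseteq\{1,2,3,4\}$, $A[\alpha]$ denotes the principal submatrix of $A$ with rows and columns indexed by $\alpha$, and $\Delta_\alpha:=\det A[\alpha]$. For specific index sets the indices are listed as subscripts, e.g. $\Delta_{23}=\det A[\{2,3\}]$, $\Delta_1=a_{11}$, $\Delta_{1234}=\det A$. *)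

theory Defs
  imports Complex_Main "Jordan_Normal_Form.Determinant" "Jordan_Normal_Form.DL_Submatrix"
begin

definition positive_definite_mat :: "real mat \<Rightarrow> bool" where
  "positive_definite_mat A \<longleftrightarrow>
     square_mat A \<and>
     (\<forall>v \<in> carrier_vec (dim_row A). v \<noteq> 0\<^sub>v (dim_row A) \<longrightarrow> v \<bullet> (A *\<^sub>v v) > 0)"

text \<open>
  Index sets are subsets of \<open>{1..n}\<close>, as in usual mathematical notation, whereas matrix entries
  are numbered from 0; hence the shift by one.
\<close>

definition principal_submatrix :: "real mat \<Rightarrow> nat set \<Rightarrow> real mat" where
  "principal_submatrix A \<alpha> = submatrix A {i. Suc i \<in> \<alpha>} {i. Suc i \<in> \<alpha>}"

definition principal_minor :: "real mat \<Rightarrow> nat set \<Rightarrow> real" where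
  "principal_minor A \<alpha> = det (principal_submatrix A \<alpha>)"

definition R2 :: "real mat \<Rightarrow> real" where
  "R2 A = (let \<Delta> = principal_minor A in
     ((\<Delta> {1,2,3,4})\<^sup>2 * \<Delta> {2,3} * \<Delta> {2,4} * \<Delta> {3,4} * \<Delta> {1}) /
     (\<Delta> {1,2,3} * \<Delta> {1,2,4} * \<Delta> {1,3,4} * \<Delta> {2,3,4} * \<Delta> {2} * \<Delta> {3} * \<Delta> {4}))"

definition R3 :: "real mat \<Rightarrow> real" where
  "R3 A = (let \<Delta> = principal_minor A in
     (\<Delta> {1,2,3,4} * \<Delta> {2,3} * \<Delta> {2,4} * \<Delta> {3,4} * (\<Delta> {1})\<^sup>2) /
     (\<Delta> {2,3,4} * \<Delta> {1,2} * \<Delta> {1,3} * \<Delta> {1,4} * \<Delta> {2} * \<Delta> {3} * \<Delta> {4}))"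

end

theory Submission
  imports Defs "HOL-Analysis.Elementary_Topology"
begin

text \<open>
  Let \<open>C = A[{2,3,4}]\<close> and let \<open>(u, v, w)\<close> be the rest of the first row of \<open>A\<close>. Both quotients are
  invariant under the scaling \<open>A \<mapsto> DAD\<close> with \<open>D\<close> diagonal and invertible, so \<open>A\<close> may be taken to have unit
  diagonal. Write \<open>x, y, z\<close> for the off-diagonal entries of \<open>C\<close>, \<open>d = det C\<close> and
  \<open>P = (1 - x\<^sup>2)(1 - y\<^sup>2)(1 - z\<^sup>2)\<close>. Both inequalities then bound a function of a free vector
  \<open>(a, b, c)\<close> attached to a fixed correlation matrix. That function has an extremum by compactness,
  and at a critical point the inequality becomes elementary algebra.

  For \<open>R3\<close> the claim is \<open>P (d - q) \<le> d (1 - a\<^sup>2)(1 - b\<^sup>2)(1 - c\<^sup>2)\<close>, where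
  \<open>t = (a, b, c) = (u, v, w)\<close> and \<open>q = t\<^sup>T adj(C) t\<close>, on the ellipsoid \<open>q \<le> d\<close> (that is, \<open>det A \<ge> 0\<close>). On the boundary the left side
  vanishes. At an interior critical point, with \<open>s1 = a\<^sup>2 / (1 - a\<^sup>2)\<close> and so on, the claim reads
  \<open>P \<le> (1 - a\<^sup>2)(1 - b\<^sup>2)(1 - c\<^sup>2)(1 + s1 + s2 + s3)\<close>. If it failed by a positive amount, the critical
  equations would express \<open>x, y, z\<close> through \<open>s1, s2, s3\<close> and this amount; the resulting value of
  \<open>P\<close> is too small (lemmas \<open>critical_product_bound\<close> and \<open>R3_at_critical_point\<close>).

  For \<open>R2\<close> one passes to inverses: let \<open>F\<close> be \<open>adj(C)\<close> rescaled to unit diagonal. Inverting the Schur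
  complement of the corner entry turns the claim into
  \<open>det F \<cdot> det (F + ww\<^sup>T) \<le> P(F) \<Prod>(1 + w\<^sub>i\<^sup>2)\<close> for every vector \<open>w\<close>. With \<open>w\<^sub>i = tan \<theta>\<^sub>i\<close> the quotient
  \<open>M = det (F + ww\<^sup>T) / \<Prod>(1 + w\<^sub>i\<^sup>2)\<close> is a continuous function on a cube, and \<open>M \<le> P / d\<close> has to be
  shown at its maximum; here \<open>x, y, z, d, P\<close> belong to \<open>F\<close>. If \<open>d \<le> P\<close>, Hadamard's inequality gives \<open>M \<le> 1 \<le> P / d\<close>. Otherwise
  \<open>x y z > 0\<close>. On the faces of the cube \<open>M\<close> is at most one of \<open>1 - x\<^sup>2\<close>, \<open>1 - y\<^sup>2\<close>, \<open>1 - z\<^sup>2\<close>, and each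
  of these is at most \<open>P / d\<close>. At a critical point inside, \<open>F + ww\<^sup>T\<close> has a zero in each off-diagonal
  position \<open>(i, j)\<close> with \<open>w\<^sub>i \<noteq> 0\<close> and \<open>w\<^sub>j \<noteq> 0\<close>. All three \<open>w\<^sub>i\<close> cannot be nonzero, since then
  \<open>x y z = - (w\<^sub>1 w\<^sub>2 w\<^sub>3)\<^sup>2\<close>; the remaining cases are explicit (lemma \<open>R2_at_critical_point\<close>).
\<close>

section \<open>Symmetric three by three determinants\<close>

text \<open>The determinant of the symmetric matrix with diagonal \<open>p, q, r\<close> and entries \<open>x, y, z\<close> at the
  positions \<open>(1,2)\<close>, \<open>(1,3)\<close>, \<open>(2,3)\<close>.\<close>

definition det3 :: "real \<Rightarrow> real \<Rightarrow> real \<Rightarrow> real \<Rightarrow> real \<Rightarrow> real \<Rightarrow> real" where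
  "det3 p q r x y z = p * q * r + 2 * x * y * z - p * z\<^sup>2 - q * y\<^sup>2 - r * x\<^sup>2"

text \<open>The quadratic form of the adjugate of that matrix. It carries the dependence of a bordered
  determinant, and of a rank one update, on the bordering vector.\<close>

definition adj_form :: "real \<Rightarrow> real \<Rightarrow> real \<Rightarrow> real \<Rightarrow> real \<Rightarrow> real \<Rightarrow> real \<Rightarrow> real \<Rightarrow> real \<Rightarrow> real" where
  "adj_form p q r x y z a b c =
     (q * r - z\<^sup>2) * a\<^sup>2 + (p * r - y\<^sup>2) * b\<^sup>2 + (p * q - x\<^sup>2) * c\<^sup>2
     + 2 * (y * z - r * x) * a * b + 2 * (x * z - q * y) * a * c + 2 * (x * y - p * z) * b * c"

lemma det3_rank_one_update:
  "det3 (1 + a\<^sup>2) (1 + b\<^sup>2) (1 + c\<^sup>2) (x + a * b) (y + a * c) (z + b * c)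
     = det3 1 1 1 x y z + adj_form 1 1 1 x y z a b c"
  by (simp add: det3_def adj_form_def power2_eq_square algebra_simps)

text \<open>Hadamard's inequality, from arithmetic and geometric means applied to \<open>q y\<^sup>2\<close> and \<open>r x\<^sup>2\<close>.\<close>

lemma det3_le_diag:
  fixes x y z :: real
  assumes pos: "0 \<le> p" "0 \<le> q" "0 \<le> r" and x: "x\<^sup>2 \<le> p * q" and y: "y\<^sup>2 \<le> p * r" and z: "z\<^sup>2 \<le> q * r"
  shows "det3 p q r x y z \<le> p * q * r"
proof -
  have "(2 * x * y * z)\<^sup>2 \<le> (q * y\<^sup>2 + r * x\<^sup>2)\<^sup>2"
  proof -
    have "(2 * x * y * z)\<^sup>2 = 4 * (x\<^sup>2 * y\<^sup>2) * z\<^sup>2" by (simp add: power2_eq_square)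
    also have "\<dots> \<le> 4 * (x\<^sup>2 * y\<^sup>2) * (q * r)" using z by (intro mult_left_mono) auto
    also have "\<dots> = (q * y\<^sup>2 + r * x\<^sup>2)\<^sup>2 - (q * y\<^sup>2 - r * x\<^sup>2)\<^sup>2"
      by (simp add: power2_eq_square algebra_simps)
    also have "\<dots> \<le> (q * y\<^sup>2 + r * x\<^sup>2)\<^sup>2" by simp
    finally show ?thesis .
  qed
  moreover have "0 \<le> q * y\<^sup>2 + r * x\<^sup>2" using pos by simp
  ultimately have "2 * x * y * z \<le> q * y\<^sup>2 + r * x\<^sup>2" using power2_le_imp_le by blast
  moreover have "0 \<le> p * z\<^sup>2" using pos by simp
  ultimately show ?thesis unfolding det3_def by linarith
qed

lemma prod_ge_det3_if_nonpos:
  fixes x y z :: real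
  assumes "x\<^sup>2 \<le> 1" "x * y * z \<le> 0"
  shows "det3 1 1 1 x y z \<le> (1 - x\<^sup>2) * (1 - y\<^sup>2) * (1 - z\<^sup>2)"
proof -
  have "(1 - x\<^sup>2) * (1 - y\<^sup>2) * (1 - z\<^sup>2) - det3 1 1 1 x y z
     = (1 - x\<^sup>2) * (y\<^sup>2 * z\<^sup>2) + x\<^sup>2 * y\<^sup>2 + x\<^sup>2 * z\<^sup>2 - 2 * (x * y * z)"
    by (simp add: det3_def power2_eq_square algebra_simps)
  moreover have "0 \<le> (1 - x\<^sup>2) * (y\<^sup>2 * z\<^sup>2)" using assms by simp
  moreover have "0 \<le> x\<^sup>2 * y\<^sup>2" "0 \<le> x\<^sup>2 * z\<^sup>2" by auto
  ultimately show ?thesis using assms by linarith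
qed

text \<open>Divided by \<open>1 - x\<^sup>2\<close>, the first claim says \<open>d \<le> (1 - y\<^sup>2)(1 - z\<^sup>2)\<close>. The gap is \<open>(x - y z)\<^sup>2\<close>,
  where \<open>y z\<close> is the correlation of the first two coordinates that makes them conditionally
  independent given the third.\<close>

lemma det3_times_minor_le_prod:
  fixes x y z :: real
  defines "d \<equiv> det3 1 1 1 x y z" and "P \<equiv> (1 - x\<^sup>2) * (1 - y\<^sup>2) * (1 - z\<^sup>2)"
  assumes "x\<^sup>2 \<le> 1" "y\<^sup>2 \<le> 1" "z\<^sup>2 \<le> 1"
  shows "d * (1 - x\<^sup>2) \<le> P" "d * (1 - y\<^sup>2) \<le> P" "d * (1 - z\<^sup>2) \<le> P"
proof -
  have "P - d * (1 - x\<^sup>2) = (1 - x\<^sup>2) * (x - y * z)\<^sup>2"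
    "P - d * (1 - y\<^sup>2) = (1 - y\<^sup>2) * (y - x * z)\<^sup>2"
    "P - d * (1 - z\<^sup>2) = (1 - z\<^sup>2) * (z - x * y)\<^sup>2"
    by (simp_all add: P_def d_def det3_def power2_eq_square algebra_simps)
  moreover have "0 \<le> (1 - x\<^sup>2) * (x - y * z)\<^sup>2" "0 \<le> (1 - y\<^sup>2) * (y - x * z)\<^sup>2"
    "0 \<le> (1 - z\<^sup>2) * (z - x * y)\<^sup>2" using assms by simp_all
  ultimately show "d * (1 - x\<^sup>2) \<le> P" "d * (1 - y\<^sup>2) \<le> P" "d * (1 - z\<^sup>2) \<le> P" by linarith+
qed

lemma det3_le_minor:
  fixes x y z :: real
  assumes "x\<^sup>2 < 1" "y\<^sup>2 \<le> 1"
  shows "det3 1 1 1 x y z \<le> 1 - x\<^sup>2"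
proof -
  have "1 - x\<^sup>2 - det3 1 1 1 x y z = (z - x * y)\<^sup>2 + (1 - x\<^sup>2) * y\<^sup>2"
    by (simp add: det3_def power2_eq_square algebra_simps)
  moreover have "\<dots> \<ge> 0" using assms by simp
  ultimately show ?thesis by linarith
qed

text \<open>Eliminating \<open>b - x a\<close> and \<open>c - y a\<close> by completing the square: the inverse of a correlation
  matrix dominates the projection to the first coordinate. This bounds the ellipsoid
  \<open>adj_form \<le> det3\<close>.\<close>

lemma adj_form_ge:
  assumes "0 < det3 1 1 1 x y z" "x\<^sup>2 < 1"
  shows "det3 1 1 1 x y z * a\<^sup>2 \<le> adj_form 1 1 1 x y z a b c"
proof -
  define e f where "e = b - x * a" and "f = c - y * a"
  have "(1 - x\<^sup>2) * (adj_form 1 1 1 x y z a b c - det3 1 1 1 x y z * a\<^sup>2)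
     = ((1 - x\<^sup>2) * f - (z - x * y) * e)\<^sup>2 + det3 1 1 1 x y z * e\<^sup>2"
    by (simp add: e_def f_def adj_form_def det3_def power2_eq_square algebra_simps)
  also have "\<dots> \<ge> 0" using assms by simp
  finally have "0 \<le> (1 - x\<^sup>2) * (adj_form 1 1 1 x y z a b c - det3 1 1 1 x y z * a\<^sup>2)" .
  thus ?thesis using assms by (simp add: zero_le_mult_iff)
qed

text \<open>Both extremal problems are quadratic in each single variable, so this one-variable first-order
  condition yields all critical equations.\<close>

lemma local_min_quadratic:
  fixes k0 k1 k2 t0 :: real
  assumes "\<delta> > 0" and "\<And>t. \<bar>t0 - t\<bar> < \<delta> \<Longrightarrow> k0 + k1 * t0 + k2 * t0\<^sup>2 \<le> k0 + k1 * t + k2 * t\<^sup>2"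
  shows "k1 + 2 * k2 * t0 = 0"
proof -
  have "((\<lambda>t. k0 + k1 * t + k2 * t\<^sup>2) has_real_derivative (k1 + 2 * k2 * t0)) (at t0)"
    by (auto intro!: derivative_eq_intros)
  thus ?thesis using DERIV_local_min assms by blast
qed

section \<open>The algebraic inequality at critical points for the third quotient\<close>

lemma prod3_mono:
  fixes a b c :: real
  assumes "0 \<le> a" "0 \<le> b" "0 \<le> c" "a \<le> a'" "b \<le> b'" "c \<le> c'"
  shows "a * b * c \<le> a' * b' * c'"
  using assms by (intro mult_mono mult_nonneg_nonneg) auto

text \<open>Here \<open>s1 = u1 a\<close> and \<open>s2 = u2 b\<close> at a critical point, and \<open>m\<close> is the excess of \<open>x u1 u2\<close> over its value
  for \<open>x = a b\<close>. The second bound is the expansion of \<open>x\<^sup>2 (u1 u2)\<^sup>2 = (s1 s2 + m)\<^sup>2\<close> without the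
  term \<open>m\<^sup>2\<close>.\<close>

lemma pair_bounds:
  fixes x s1 s2 u1 u2 m :: real
  assumes s: "0 \<le> s1" "0 \<le> s2" and u: "u1\<^sup>2 = s1 * (1 + s1)" "u2\<^sup>2 = s2 * (1 + s2)"
    and m: "m = x * (u1 * u2) - s1 * s2"
  shows "(1 - x\<^sup>2) * (1 + s1) * (1 + s2) \<le> (1 + s1) * (1 + s2)"
    and "(1 - x\<^sup>2) * (1 + s1) * (1 + s2) \<le> 1 + s1 + s2 - 2 * m"
proof -
  have nn: "0 \<le> (1 + s1) * (1 + s2)" using s by simp
  have "0 \<le> x\<^sup>2 * ((1 + s1) * (1 + s2))" using nn by (rule mult_nonneg_nonneg[OF zero_le_power2])
  thus 1: "(1 - x\<^sup>2) * (1 + s1) * (1 + s2) \<le> (1 + s1) * (1 + s2)" by (simp add: algebra_simps)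
  show "(1 - x\<^sup>2) * (1 + s1) * (1 + s2) \<le> 1 + s1 + s2 - 2 * m"
  proof (cases "s1 * s2 = 0")
    case True
    hence "(u1 * u2)\<^sup>2 = 0" using u by (auto simp: power_mult_distrib)
    hence "m = 0" using m True by simp
    moreover have "(1 + s1) * (1 + s2) = 1 + s1 + s2" using True by (simp add: algebra_simps)
    ultimately show ?thesis using 1 by simp
  next
    case False
    hence pos: "s1 * s2 > 0" using s by (simp add: zero_less_mult_iff less_le)
    have "(s1 * s2 + m)\<^sup>2 = x\<^sup>2 * (u1\<^sup>2 * u2\<^sup>2)" using m by (simp add: power_mult_distrib)
    also have "\<dots> = s1 * s2 * (x\<^sup>2 * ((1 + s1) * (1 + s2)))" by (simp add: u algebra_simps)
    finally have e: "(s1 * s2 + m)\<^sup>2 = s1 * s2 * (x\<^sup>2 * ((1 + s1) * (1 + s2)))" .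
    have "s1 * s2 * (s1 * s2 + 2 * m) \<le> (s1 * s2 + m)\<^sup>2"
      by (simp add: power2_eq_square algebra_simps)
    hence "s1 * s2 + 2 * m \<le> x\<^sup>2 * ((1 + s1) * (1 + s2))"
      unfolding e using pos by (simp only: mult_le_cancel_left_pos)
    thus ?thesis by (simp add: algebra_simps)
  qed
qed

lemma product_bound_nonneg:
  fixes s1 s2 s3 :: real
  assumes s: "0 \<le> s1" "0 \<le> s2" "0 \<le> s3" and A: "0 \<le> A12" "0 \<le> A13" "0 \<le> A23"
    and "A12 \<le> 1 + s1 + s2" "A13 \<le> 1 + s1 + s3" "A23 \<le> 1 + s2 + s3"
  shows "A12 * A13 * A23 \<le> (1 + s1 + s2 + s3) * ((1 + s1) * (1 + s2) * (1 + s3))"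
proof -
  have "A12 * A13 * A23 \<le> (1 + s1 + s2) * (1 + s1 + s3) * (1 + s2 + s3)"
    using assms by (intro prod3_mono) auto
  also have "\<dots> + s1 * s2 * s3 * (2 + s1 + s2 + s3)
      = (1 + s1 + s2 + s3) * ((1 + s1) * (1 + s2) * (1 + s3))"
    by (simp add: algebra_simps)
  moreover have "0 \<le> s1 * s2 * s3 * (2 + s1 + s2 + s3)" using s by simp
  ultimately show ?thesis by linarith
qed

text \<open>One of the three factors may exceed \<open>1 + s1 + s2\<close> by \<open>2 \<delta>\<close>, at the price that both others
  decrease by \<open>2 \<delta>\<close>. One decrease is given away, the other compensates the excess. For large \<open>\<delta>\<close> the
  second bound on the exceptional factor takes over.\<close>

lemma product_bound_neg:
  fixes s1 s2 s3 \<delta> :: real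
  assumes s: "0 \<le> s1" "0 \<le> s2" "s1 + s2 \<le> s3" and \<delta>: "0 \<le> \<delta>"
    and A: "0 \<le> A12" "0 \<le> A13" "0 \<le> A23"
    and b12: "A12 \<le> 1 + s1 + s2 + 2 * \<delta>" "A12 \<le> (1 + s1) * (1 + s2)"
    and b13: "A13 \<le> 1 + s1 + s3 - 2 * \<delta>" and b23: "A23 \<le> 1 + s2 + s3 - 2 * \<delta>"
  shows "A12 * A13 * A23 \<le> (1 + s1 + s2 + s3) * ((1 + s1) * (1 + s2) * (1 + s3))"
proof -
  define W where "W = (1 + s3) * (1 + s1 + s2 + s3)"
  define X where "X = (1 + s1) * (1 + s2)"
  define h where "h = s1 * s2 - 2 * \<delta>"
  have W0: "0 \<le> W" unfolding W_def using s by (intro mult_nonneg_nonneg) auto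
  have X0: "0 \<le> X" unfolding X_def using s by (intro mult_nonneg_nonneg) auto
  have "A13 * A23 \<le> (1 + s1 + s3 - 2 * \<delta>) * (1 + s2 + s3 - 2 * \<delta>)"
    using A b13 b23 by (intro mult_mono) auto
  also have "\<dots> \<le> (1 + s1 + s3) * (1 + s2 + s3 - 2 * \<delta>)"
    using A b23 \<delta> by (intro mult_right_mono) auto
  also have "\<dots> = W + h - 2 * \<delta> * (s1 + s3)"
    by (simp add: W_def h_def algebra_simps)
  also have "\<dots> \<le> W + h" using \<delta> s by simp
  finally have 1: "A13 * A23 \<le> W + h" .
  have 0: "0 \<le> A13 * A23" using A by simp
  have "A12 * (A13 * A23) \<le> X * W"
  proof (cases "0 \<le> h")
    case False
    have "A12 * (A13 * A23) \<le> X * W"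
      using 1 0 False b12(2) A X0 unfolding X_def[symmetric] by (intro mult_mono) auto
    thus ?thesis .
  next
    case True
    have X_le: "X \<le> W"
    proof -
      have "(1 + s1) * (1 + s2) \<le> (1 + s3) * (1 + s1 + s2 + s3)"
        using s by (intro mult_mono) auto
      thus ?thesis by (simp add: X_def W_def)
    qed
    have "A12 \<le> X - h" using b12(1) by (simp add: X_def h_def algebra_simps)
    hence "A12 * (A13 * A23) \<le> (X - h) * (W + h)"
      using 1 0 A by (intro mult_mono) auto
    also have "\<dots> = X * W - h * (W - X) - h * h" by (simp add: algebra_simps)
    also have "\<dots> \<le> X * W"
      using mult_nonneg_nonneg[OF True, of "W - X"] zero_le_square[of h] X_le by linarith
    finally show ?thesis .
  qed
  thus ?thesis by (simp add: X_def W_def mult.assoc) (simp add: algebra_simps)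
qed

text \<open>The three linear equations determine \<open>m12 = \<kappa> (s1 + s2 - s3) / 2\<close> and its analogues, so at most
  one of the \<open>m\<close> is negative, and then the corresponding sum of two \<open>s\<close> is below the third.\<close>

lemma critical_product_bound:
  fixes s1 s2 s3 \<kappa> :: real
  assumes s: "0 \<le> s1" "0 \<le> s2" "0 \<le> s3" and \<kappa>: "0 < \<kappa>"
    and m: "m12 + m13 = \<kappa> * s1" "m12 + m23 = \<kappa> * s2" "m13 + m23 = \<kappa> * s3"
    and A0: "0 \<le> A12" "0 \<le> A13" "0 \<le> A23"
    and A: "A12 \<le> (1 + s1) * (1 + s2)" "A13 \<le> (1 + s1) * (1 + s3)" "A23 \<le> (1 + s2) * (1 + s3)"
    and B: "A12 \<le> 1 + s1 + s2 - 2 * m12" "A13 \<le> 1 + s1 + s3 - 2 * m13" "A23 \<le> 1 + s2 + s3 - 2 * m23"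
  shows "A12 * A13 * A23 \<le> (1 + s1 + s2 + s3) * ((1 + s1) * (1 + s2) * (1 + s3))"
proof -
  have nn: "0 \<le> \<kappa> * s1" "0 \<le> \<kappa> * s2" "0 \<le> \<kappa> * s3" using s \<kappa> by auto
  have e: "\<kappa> * (s3 - s1 - s2) = - 2 * m12" "\<kappa> * (s2 - s1 - s3) = - 2 * m13"
     "\<kappa> * (s1 - s2 - s3) = - 2 * m23" using m by (auto simp: algebra_simps)
  consider "0 \<le> m12" "0 \<le> m13" "0 \<le> m23" | "m12 < 0" | "m13 < 0" | "m23 < 0" by linarith
  thus ?thesis
  proof cases
    case 1
    thus ?thesis using s A0 B by (intro product_bound_nonneg) auto
  next
    case 2
    hence "0 < \<kappa> * (s3 - s1 - s2)" using e by simp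
    hence "s1 + s2 \<le> s3" using \<kappa> by (simp add: zero_less_mult_iff)
    thus ?thesis using 2 s A0 A B m nn by (intro product_bound_neg[where \<delta> = "- m12"]) auto
  next
    case 3
    hence "0 < \<kappa> * (s2 - s1 - s3)" using e by simp
    hence "s1 + s3 \<le> s2" using \<kappa> by (simp add: zero_less_mult_iff)
    hence "A13 * A12 * A23 \<le> (1 + s1 + s3 + s2) * ((1 + s1) * (1 + s3) * (1 + s2))"
      using 3 s A0 A B m nn by (intro product_bound_neg[where \<delta> = "- m13"]) (auto simp: ac_simps)
    thus ?thesis by (simp add: ac_simps)
  next
    case 4
    hence "0 < \<kappa> * (s1 - s2 - s3)" using e by simp
    hence "s2 + s3 \<le> s1" using \<kappa> by (simp add: zero_less_mult_iff)
    hence "A23 * A12 * A13 \<le> (1 + s2 + s3 + s1) * ((1 + s2) * (1 + s3) * (1 + s1))"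
      using 4 s A0 A B m nn by (intro product_bound_neg[where \<delta> = "- m23"]) (auto simp: ac_simps)
    thus ?thesis by (simp add: ac_simps)
  qed
qed

text \<open>The three critical equations are \<open>P adj(C) t = d (1 - a\<^sup>2)(1 - b\<^sup>2)(1 - c\<^sup>2) u\<close> with
  \<open>t = (a, b, c)\<close> and \<open>u = (a / (1 - a\<^sup>2), \<dots>)\<close>. Pairing them with \<open>t\<close>
  evaluates the quadratic form, which turns the claim into \<open>P \<le> (1 - a\<^sup>2)(1 - b\<^sup>2)(1 - c\<^sup>2)(1 + s1 + s2 + s3)\<close>. Multiplying them by \<open>C\<close> gives linear
  equations for \<open>x, y, z\<close>.\<close>

lemma R3_at_critical_point:
  fixes x y z a b c :: real
  defines "d \<equiv> det3 1 1 1 x y z" and "P \<equiv> (1 - x\<^sup>2) * (1 - y\<^sup>2) * (1 - z\<^sup>2)"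
  assumes p: "x\<^sup>2 < 1" "y\<^sup>2 < 1" "z\<^sup>2 < 1" and d: "0 < d"
    and v: "a\<^sup>2 < 1" "b\<^sup>2 < 1" "c\<^sup>2 < 1"
    and crit: "P * ((1 - z\<^sup>2) * a + (y * z - x) * b + (x * z - y) * c) = d * ((1 - b\<^sup>2) * (1 - c\<^sup>2) * a)"
      "P * ((y * z - x) * a + (1 - y\<^sup>2) * b + (x * y - z) * c) = d * ((1 - a\<^sup>2) * (1 - c\<^sup>2) * b)"
      "P * ((x * z - y) * a + (x * y - z) * b + (1 - x\<^sup>2) * c) = d * ((1 - a\<^sup>2) * (1 - b\<^sup>2) * c)"
  shows "P * (d - adj_form 1 1 1 x y z a b c) \<le> d * ((1 - a\<^sup>2) * (1 - b\<^sup>2) * (1 - c\<^sup>2))"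
proof -
  define s1 s2 s3 where "s1 = a\<^sup>2 / (1 - a\<^sup>2)" and "s2 = b\<^sup>2 / (1 - b\<^sup>2)" and "s3 = c\<^sup>2 / (1 - c\<^sup>2)"
  define u1 u2 u3 where "u1 = a * (1 + s1)" and "u2 = b * (1 + s2)" and "u3 = c * (1 + s3)"
  define V where "V = (1 - a\<^sup>2) * (1 - b\<^sup>2) * (1 - c\<^sup>2)"
  define S where "S = s1 + s2 + s3"
  \<comment> \<open>The amount by which the reduced claim \<open>P / V \<le> 1 + S\<close> fails.\<close>
  define \<kappa> where "\<kappa> = P / V - 1 - S"
  define m12 m13 m23 where "m12 = x * (u1 * u2) - s1 * s2" and "m13 = y * (u1 * u3) - s1 * s3"
    and "m23 = z * (u2 * u3) - s2 * s3"
  have s0: "0 \<le> s1" "0 \<le> s2" "0 \<le> s3" using v by (auto simp: s1_def s2_def s3_def)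
  have inv: "(1 - a\<^sup>2) * (1 + s1) = 1" "(1 - b\<^sup>2) * (1 + s2) = 1" "(1 - c\<^sup>2) * (1 + s3) = 1"
    using v by (auto simp: s1_def s2_def s3_def field_simps)
  have au: "a * u1 = s1" "b * u2 = s2" "c * u3 = s3"
    using v by (auto simp: u1_def u2_def u3_def s1_def s2_def s3_def field_simps power2_eq_square)
  have "u1\<^sup>2 = (a * u1) * (1 + s1)" "u2\<^sup>2 = (b * u2) * (1 + s2)" "u3\<^sup>2 = (c * u3) * (1 + s3)"
    by (simp_all add: u1_def u2_def u3_def power2_eq_square)
  hence uu: "u1\<^sup>2 = s1 * (1 + s1)" "u2\<^sup>2 = s2 * (1 + s2)" "u3\<^sup>2 = s3 * (1 + s3)"
    by (simp_all only: au)
  have V0: "0 < V" using v by (simp add: V_def)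
  have Vs: "V * ((1 + s1) * (1 + s2) * (1 + s3)) = 1"
  proof -
    have "V * ((1 + s1) * (1 + s2) * (1 + s3))
      = ((1 - a\<^sup>2) * (1 + s1)) * ((1 - b\<^sup>2) * (1 + s2)) * ((1 - c\<^sup>2) * (1 + s3))"
      unfolding V_def by (simp only: ac_simps)
    thus ?thesis by (simp only: inv mult_1)
  qed
  have "V * u1 = (1 - a\<^sup>2) * (1 + s1) * ((1 - b\<^sup>2) * (1 - c\<^sup>2) * a)"
    "V * u2 = (1 - b\<^sup>2) * (1 + s2) * ((1 - a\<^sup>2) * (1 - c\<^sup>2) * b)"
    "V * u3 = (1 - c\<^sup>2) * (1 + s3) * ((1 - a\<^sup>2) * (1 - b\<^sup>2) * c)"
    unfolding V_def u1_def u2_def u3_def by (simp_all only: ac_simps)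
  hence U: "(1 - b\<^sup>2) * (1 - c\<^sup>2) * a = V * u1" "(1 - a\<^sup>2) * (1 - c\<^sup>2) * b = V * u2"
     "(1 - a\<^sup>2) * (1 - b\<^sup>2) * c = V * u3"
    by (simp_all only: inv mult_1)
  note crit' = crit[unfolded U]
  \<comment> \<open>The critical equations multiplied by the rows of \<open>C\<close>, using \<open>C adj(C) = d I\<close>.\<close>
  have l1: "P * a = V * (u1 + x * u2 + y * u3)"
  proof -
    have "d * (P * a) = P * ((1 - z\<^sup>2) * a + (y * z - x) * b + (x * z - y) * c)
        + x * (P * ((y * z - x) * a + (1 - y\<^sup>2) * b + (x * y - z) * c))
        + y * (P * ((x * z - y) * a + (x * y - z) * b + (1 - x\<^sup>2) * c))"
      unfolding d_def det3_def by (simp add: power2_eq_square algebra_simps)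
    also have "\<dots> = d * (V * u1) + x * (d * (V * u2)) + y * (d * (V * u3))" by (simp only: crit')
    also have "\<dots> = d * (V * (u1 + x * u2 + y * u3))" by (simp add: algebra_simps)
    finally have "d * (P * a) = d * (V * (u1 + x * u2 + y * u3))" .
    thus ?thesis using d by simp
  qed
  have l2: "P * b = V * (x * u1 + u2 + z * u3)"
  proof -
    have "d * (P * b) = x * (P * ((1 - z\<^sup>2) * a + (y * z - x) * b + (x * z - y) * c))
        + P * ((y * z - x) * a + (1 - y\<^sup>2) * b + (x * y - z) * c)
        + z * (P * ((x * z - y) * a + (x * y - z) * b + (1 - x\<^sup>2) * c))"
      unfolding d_def det3_def by (simp add: power2_eq_square algebra_simps)
    also have "\<dots> = x * (d * (V * u1)) + d * (V * u2) + z * (d * (V * u3))" by (simp only: crit')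
    also have "\<dots> = d * (V * (x * u1 + u2 + z * u3))" by (simp add: algebra_simps)
    finally have "d * (P * b) = d * (V * (x * u1 + u2 + z * u3))" .
    thus ?thesis using d by simp
  qed
  have l3: "P * c = V * (y * u1 + z * u2 + u3)"
  proof -
    have "d * (P * c) = y * (P * ((1 - z\<^sup>2) * a + (y * z - x) * b + (x * z - y) * c))
        + z * (P * ((y * z - x) * a + (1 - y\<^sup>2) * b + (x * y - z) * c))
        + P * ((x * z - y) * a + (x * y - z) * b + (1 - x\<^sup>2) * c)"
      unfolding d_def det3_def by (simp add: power2_eq_square algebra_simps)
    also have "\<dots> = y * (d * (V * u1)) + z * (d * (V * u2)) + d * (V * u3)" by (simp only: crit')
    also have "\<dots> = d * (V * (y * u1 + z * u2 + u3))" by (simp add: algebra_simps)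
    finally have "d * (P * c) = d * (V * (y * u1 + z * u2 + u3))" .
    thus ?thesis using d by simp
  qed
  have "P * adj_form 1 1 1 x y z a b c = a * (P * ((1 - z\<^sup>2) * a + (y * z - x) * b + (x * z - y) * c))
      + b * (P * ((y * z - x) * a + (1 - y\<^sup>2) * b + (x * y - z) * c))
      + c * (P * ((x * z - y) * a + (x * y - z) * b + (1 - x\<^sup>2) * c))"
    unfolding adj_form_def by (simp add: power2_eq_square algebra_simps)
  also have "\<dots> = a * (d * (V * u1)) + b * (d * (V * u2)) + c * (d * (V * u3))"
    by (simp only: crit')
  also have "\<dots> = d * (V * (a * u1 + b * u2 + c * u3))" by (simp add: algebra_simps)
  finally have form: "P * adj_form 1 1 1 x y z a b c = d * (V * S)" by (simp only: au S_def)
  have "P \<le> V * (1 + S)"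
  proof (rule ccontr)
    assume "\<not> P \<le> V * (1 + S)"
    hence \<kappa>0: "0 < \<kappa>" using V0 by (simp add: \<kappa>_def field_simps)
    have q: "(P / V) * a = u1 + x * u2 + y * u3" "(P / V) * b = x * u1 + u2 + z * u3"
      "(P / V) * c = y * u1 + z * u2 + u3"
      using l1 l2 l3 V0 by (simp_all add: field_simps)
    have k: "P / V = \<kappa> + 1 + S" by (simp add: \<kappa>_def)
    have m1: "m12 + m13 = \<kappa> * s1"
    proof -
      have "(\<kappa> + 1 + S) * (a * u1) = u1 * (u1 + x * u2 + y * u3)"
        using q(1)[unfolded k] by (metis mult.assoc mult.commute)
      hence "(\<kappa> + 1 + S) * s1 = u1\<^sup>2 + (m12 + m13 + s1 * (S - s1))"
        unfolding au m12_def m13_def m23_def S_def by (simp add: power2_eq_square algebra_simps)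
      thus ?thesis unfolding uu by (simp add: algebra_simps)
    qed
    have m2: "m12 + m23 = \<kappa> * s2"
    proof -
      have "(\<kappa> + 1 + S) * (b * u2) = u2 * (x * u1 + u2 + z * u3)"
        using q(2)[unfolded k] by (metis mult.assoc mult.commute)
      hence "(\<kappa> + 1 + S) * s2 = u2\<^sup>2 + (m12 + m23 + s2 * (S - s2))"
        unfolding au m12_def m13_def m23_def S_def by (simp add: power2_eq_square algebra_simps)
      thus ?thesis unfolding uu by (simp add: algebra_simps)
    qed
    have m3: "m13 + m23 = \<kappa> * s3"
    proof -
      have "(\<kappa> + 1 + S) * (c * u3) = u3 * (y * u1 + z * u2 + u3)"
        using q(3)[unfolded k] by (metis mult.assoc mult.commute)
      hence "(\<kappa> + 1 + S) * s3 = u3\<^sup>2 + (m13 + m23 + s3 * (S - s3))"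
        unfolding au m12_def m13_def m23_def S_def by (simp add: power2_eq_square algebra_simps)
      thus ?thesis unfolding uu by (simp add: algebra_simps)
    qed
    note b12 = pair_bounds[OF s0(1,2) uu(1,2) m12_def]
    note b13 = pair_bounds[OF s0(1,3) uu(1,3) m13_def]
    note b23 = pair_bounds[OF s0(2,3) uu(2,3) m23_def]
    have nn: "0 \<le> (1 - x\<^sup>2) * (1 + s1) * (1 + s2)" "0 \<le> (1 - y\<^sup>2) * (1 + s1) * (1 + s3)"
      "0 \<le> (1 - z\<^sup>2) * (1 + s2) * (1 + s3)" using p s0 by auto
    define E where "E = (1 + s1) * (1 + s2) * (1 + s3)"
    have E0: "0 < E" using s0 by (simp add: E_def)
    have "(1 - x\<^sup>2) * (1 + s1) * (1 + s2) * ((1 - y\<^sup>2) * (1 + s1) * (1 + s3))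
       * ((1 - z\<^sup>2) * (1 + s2) * (1 + s3)) \<le> (1 + s1 + s2 + s3) * E"
      unfolding E_def
      by (rule critical_product_bound[OF s0 \<kappa>0 m1 m2 m3 nn
            b12(1) b13(1) b23(1) b12(2) b13(2) b23(2)])
    also have "(1 - x\<^sup>2) * (1 + s1) * (1 + s2) * ((1 - y\<^sup>2) * (1 + s1) * (1 + s3))
       * ((1 - z\<^sup>2) * (1 + s2) * (1 + s3)) = P * E * E"
      by (simp add: P_def E_def)
    finally have "P * E \<le> 1 + S" using E0 by (simp add: S_def add.assoc)
    hence "V * (P * E) \<le> V * (1 + S)" using V0 by simp
    also have "V * (P * E) = P" using Vs by (simp add: E_def mult.left_commute)
    finally show False using \<open>\<not> P \<le> V * (1 + S)\<close> by simp
  qed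
  hence "d * P \<le> d * (V * (1 + S))" using d by simp
  thus ?thesis using form unfolding V_def[symmetric] by (simp add: algebra_simps)
qed

section \<open>The third quotient for correlation matrices\<close>

text \<open>The difference of the two sides attains its minimum on the compact ellipsoid where the bordered
  determinant is nonnegative: it is nonnegative on the boundary because the left side
  vanishes there, and at an interior minimum by the critical equations.\<close>

lemma R3_normalised:
  fixes x y z a b c :: real
  defines "d \<equiv> det3 1 1 1 x y z" and "P \<equiv> (1 - x\<^sup>2) * (1 - y\<^sup>2) * (1 - z\<^sup>2)"
  assumes p: "x\<^sup>2 < 1" "y\<^sup>2 < 1" "z\<^sup>2 < 1" and d: "0 < d"
    and v: "adj_form 1 1 1 x y z a b c \<le> d"
  shows "P * (d - adj_form 1 1 1 x y z a b c) \<le> d * ((1 - a\<^sup>2) * (1 - b\<^sup>2) * (1 - c\<^sup>2))"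
proof -
  define q where "q = adj_form 1 1 1 x y z"
  define G where "G = (\<lambda>a b c. d * ((1 - a\<^sup>2) * (1 - b\<^sup>2) * (1 - c\<^sup>2)) - P * (d - q a b c))"
  define K where "K = {t :: real \<times> real \<times> real. q (fst t) (fst (snd t)) (snd (snd t)) \<le> d}"
  have ge: "d * a\<^sup>2 \<le> q a b c \<and> d * b\<^sup>2 \<le> q a b c \<and> d * c\<^sup>2 \<le> q a b c" for a b c
  proof -
    have "adj_form 1 1 1 x z y b a c = q a b c" "adj_form 1 1 1 z y x c b a = q a b c"
      "det3 1 1 1 x z y = d" "det3 1 1 1 z y x = d"
      by (simp_all add: adj_form_def det3_def q_def d_def algebra_simps)
    thus ?thesis
      using adj_form_ge[of x y z a b c] adj_form_ge[of x z y b a c] adj_form_ge[of z y x c b a] p d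
      by (simp_all add: q_def d_def)
  qed
  have cont: "continuous_on UNIV (\<lambda>t :: real \<times> real \<times> real. q (fst t) (fst (snd t)) (snd (snd t)))"
    unfolding q_def adj_form_def by (intro continuous_intros)
  have "compact K"
  proof -
    have "closed K" unfolding K_def by (intro closed_Collect_le cont continuous_intros)
    moreover have "K \<subseteq> {-1..1} \<times> {-1..1} \<times> {-1..1}"
    proof
      fix t assume "t \<in> K"
      then obtain a b c where t: "t = (a, b, c)" "q a b c \<le> d" by (cases t) (auto simp: K_def)
      have "d * a\<^sup>2 \<le> d * 1" "d * b\<^sup>2 \<le> d * 1" "d * c\<^sup>2 \<le> d * 1"
        using ge[of a b c] t(2) by auto
      hence "a\<^sup>2 \<le> 1" "b\<^sup>2 \<le> 1" "c\<^sup>2 \<le> 1" using d by auto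
      thus "t \<in> {-1..1} \<times> {-1..1} \<times> {-1..1}"
        by (auto simp: t(1) abs_square_le_1 abs_le_iff)
    qed
    moreover have "compact ({-1..1 :: real} \<times> {-1..1 :: real} \<times> {-1..1 :: real})"
      by (intro compact_Times compact_Icc)
    ultimately show ?thesis by (metis closed_Int_compact inf.absorb1)
  qed
  moreover have "(a, b, c) \<in> K" using v by (simp add: K_def q_def)
  moreover have "continuous_on K (\<lambda>t. G (fst t) (fst (snd t)) (snd (snd t)))"
    unfolding G_def q_def adj_form_def by (intro continuous_intros)
  ultimately obtain t where t: "t \<in> K"
    "\<And>s. s \<in> K \<Longrightarrow> G (fst t) (fst (snd t)) (snd (snd t)) \<le> G (fst s) (fst (snd s)) (snd (snd s))"
    using continuous_attains_inf[of K "\<lambda>t. G (fst t) (fst (snd t)) (snd (snd t))"]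
    by (metis empty_iff)
  obtain a0 b0 c0 where t0: "t = (a0, b0, c0)" by (cases t) auto
  have q0: "q a0 b0 c0 \<le> d" using t(1) by (simp add: K_def t0)
  have min: "G a0 b0 c0 \<le> G a b c" if "q a b c \<le> d" for a b c
    using t(2)[of "(a, b, c)"] that by (simp add: K_def t0)
  have "0 \<le> G a0 b0 c0"
  proof (cases "q a0 b0 c0 = d")
    case True
    have "d * a0\<^sup>2 \<le> d * 1" "d * b0\<^sup>2 \<le> d * 1" "d * c0\<^sup>2 \<le> d * 1"
      using ge[of a0 b0 c0] q0 by auto
    hence "a0\<^sup>2 \<le> 1" "b0\<^sup>2 \<le> 1" "c0\<^sup>2 \<le> 1" using d by auto
    thus ?thesis using True d by (simp add: G_def)
  next
    case False
    hence q1: "q a0 b0 c0 < d" using q0 by simp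
    have "d * a0\<^sup>2 < d * 1" "d * b0\<^sup>2 < d * 1" "d * c0\<^sup>2 < d * 1"
      using ge[of a0 b0 c0] q1 by auto
    hence lt: "a0\<^sup>2 < 1" "b0\<^sup>2 < 1" "c0\<^sup>2 < 1" using d by auto
    \<comment> \<open>Small changes of one coordinate stay inside the ellipsoid, so the minimum is a local one.\<close>
    have near: "\<exists>\<delta>>0. \<forall>t. \<bar>t0 - t\<bar> < \<delta> \<longrightarrow> f t < d"
      if "isCont f t0" "f t0 < d" for f :: "real \<Rightarrow> real" and t0
    proof -
      have "eventually (\<lambda>t. f t < d) (nhds t0)"
        using that by (auto intro: order_tendstoD simp: isCont_def tendsto_at_iff_tendsto_nhds)
      thus ?thesis by (auto simp: eventually_nhds_metric dist_real_def abs_minus_commute)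
    qed
    have e1: "P * ((1 - z\<^sup>2) * a0 + (y * z - x) * b0 + (x * z - y) * c0)
        = d * ((1 - b0\<^sup>2) * (1 - c0\<^sup>2) * a0)"
    proof -
      obtain \<delta> where \<delta>: "\<delta> > 0" "\<And>t. \<bar>a0 - t\<bar> < \<delta> \<Longrightarrow> q t b0 c0 < d"
        using near[of a0 "\<lambda>t. q t b0 c0"] q1 unfolding q_def adj_form_def
        by (auto intro!: continuous_intros)
      define k0 where "k0 = d * ((1 - b0\<^sup>2) * (1 - c0\<^sup>2)) - P * (d - q 0 b0 c0)"
      define k1 where "k1 = P * (2 * (y * z - x) * b0 + 2 * (x * z - y) * c0)"
      define k2 where "k2 = P * (1 - z\<^sup>2) - d * ((1 - b0\<^sup>2) * (1 - c0\<^sup>2))"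
      have "G t b0 c0 = k0 + k1 * t + k2 * t\<^sup>2" for t
        unfolding G_def k0_def k1_def k2_def q_def adj_form_def
        by (simp add: power2_eq_square algebra_simps)
      hence "k1 + 2 * k2 * a0 = 0"
        using \<delta> min by (intro local_min_quadratic[of \<delta> a0 k0 k1 k2]) (metis less_imp_le)+
      thus ?thesis unfolding k1_def k2_def by (simp add: algebra_simps)
    qed
    have e2: "P * ((y * z - x) * a0 + (1 - y\<^sup>2) * b0 + (x * y - z) * c0)
        = d * ((1 - a0\<^sup>2) * (1 - c0\<^sup>2) * b0)"
    proof -
      obtain \<delta> where \<delta>: "\<delta> > 0" "\<And>t. \<bar>b0 - t\<bar> < \<delta> \<Longrightarrow> q a0 t c0 < d"
        using near[of b0 "\<lambda>t. q a0 t c0"] q1 unfolding q_def adj_form_def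
        by (auto intro!: continuous_intros)
      define k0 where "k0 = d * ((1 - a0\<^sup>2) * (1 - c0\<^sup>2)) - P * (d - q a0 0 c0)"
      define k1 where "k1 = P * (2 * (y * z - x) * a0 + 2 * (x * y - z) * c0)"
      define k2 where "k2 = P * (1 - y\<^sup>2) - d * ((1 - a0\<^sup>2) * (1 - c0\<^sup>2))"
      have "G a0 t c0 = k0 + k1 * t + k2 * t\<^sup>2" for t
        unfolding G_def k0_def k1_def k2_def q_def adj_form_def
        by (simp add: power2_eq_square algebra_simps)
      hence "k1 + 2 * k2 * b0 = 0"
        using \<delta> min by (intro local_min_quadratic[of \<delta> b0 k0 k1 k2]) (metis less_imp_le)+
      thus ?thesis unfolding k1_def k2_def by (simp add: algebra_simps)
    qed
    have e3: "P * ((x * z - y) * a0 + (x * y - z) * b0 + (1 - x\<^sup>2) * c0)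
        = d * ((1 - a0\<^sup>2) * (1 - b0\<^sup>2) * c0)"
    proof -
      obtain \<delta> where \<delta>: "\<delta> > 0" "\<And>t. \<bar>c0 - t\<bar> < \<delta> \<Longrightarrow> q a0 b0 t < d"
        using near[of c0 "\<lambda>t. q a0 b0 t"] q1 unfolding q_def adj_form_def
        by (auto intro!: continuous_intros)
      define k0 where "k0 = d * ((1 - a0\<^sup>2) * (1 - b0\<^sup>2)) - P * (d - q a0 b0 0)"
      define k1 where "k1 = P * (2 * (x * z - y) * a0 + 2 * (x * y - z) * b0)"
      define k2 where "k2 = P * (1 - x\<^sup>2) - d * ((1 - a0\<^sup>2) * (1 - b0\<^sup>2))"
      have "G a0 b0 t = k0 + k1 * t + k2 * t\<^sup>2" for t
        unfolding G_def k0_def k1_def k2_def q_def adj_form_def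
        by (simp add: power2_eq_square algebra_simps)
      hence "k1 + 2 * k2 * c0 = 0"
        using \<delta> min by (intro local_min_quadratic[of \<delta> c0 k0 k1 k2]) (metis less_imp_le)+
      thus ?thesis unfolding k1_def k2_def by (simp add: algebra_simps)
    qed
    show ?thesis
      using R3_at_critical_point[OF p d[unfolded d_def] lt] e1 e2 e3
      unfolding G_def q_def P_def d_def by simp
  qed
  also have "\<dots> \<le> G a b c" using min v by (simp add: q_def)
  finally show ?thesis by (simp add: G_def q_def)
qed

section \<open>The dual inequality for correlation matrices\<close>

text \<open>The case of one vanishing coordinate of \<open>w\<close> at a critical point. The updated matrix has a zero
  entry at \<open>(1,2)\<close>, so its normalised determinant is \<open>1 - y\<^sup>2 / (1 + a\<^sup>2) - z\<^sup>2 / (1 + b\<^sup>2)\<close>, and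
  \<open>a\<^sup>2 b\<^sup>2 \<le> 1\<close> says exactly that the weights \<open>1 / (1 + a\<^sup>2)\<close> and \<open>1 / (1 + b\<^sup>2)\<close> sum to at least 1.\<close>

lemma two_active_bound:
  fixes a b x y z \<pi> :: real
  assumes ab: "x = - (a * b)" and x: "x\<^sup>2 \<le> 1" and \<pi>: "1 - y\<^sup>2 \<le> \<pi>" "1 - z\<^sup>2 \<le> \<pi>"
  shows "det3 1 1 1 x y z + adj_form 1 1 1 x y z a b 0 \<le> \<pi> * ((1 + a\<^sup>2) * (1 + b\<^sup>2))"
proof -
  have e: "det3 1 1 1 x y z + adj_form 1 1 1 x y z a b 0
      = (1 + a\<^sup>2) * (1 + b\<^sup>2) - (1 + b\<^sup>2) * y\<^sup>2 - (1 + a\<^sup>2) * z\<^sup>2"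
    unfolding ab by (simp add: det3_def adj_form_def power2_eq_square algebra_simps)
  have 1: "(1 + b\<^sup>2) * (1 - \<pi>) \<le> (1 + b\<^sup>2) * y\<^sup>2" "(1 + a\<^sup>2) * (1 - \<pi>) \<le> (1 + a\<^sup>2) * z\<^sup>2"
    using \<pi> by (auto intro!: mult_left_mono)
  show ?thesis
  proof (cases "\<pi> \<le> 1")
    case True
    have "a\<^sup>2 * b\<^sup>2 \<le> 1" using ab x by (simp add: power_mult_distrib)
    hence "(1 + a\<^sup>2) * (1 + b\<^sup>2) * (1 - \<pi>) \<le> ((1 + b\<^sup>2) + (1 + a\<^sup>2)) * (1 - \<pi>)"
      using True by (intro mult_right_mono) (auto simp: algebra_simps)
    thus ?thesis using 1 e by (simp add: algebra_simps)
  next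
    case False
    have "(1 + a\<^sup>2) * (1 + b\<^sup>2) * 1 \<le> (1 + a\<^sup>2) * (1 + b\<^sup>2) * \<pi>"
      using False by (intro mult_left_mono) auto
    moreover have "0 \<le> (1 + b\<^sup>2) * y\<^sup>2" "0 \<le> (1 + a\<^sup>2) * z\<^sup>2" by auto
    ultimately show ?thesis unfolding e mult.commute[of \<pi>] by linarith
  qed
qed

text \<open>Multiplying the critical equations by the matrix, and then the \<open>i\<close>-th one by
  \<open>u\<^sub>i = w\<^sub>i / (1 + w\<^sub>i\<^sup>2)\<close>, leaves a linear system for the three products \<open>F\<^sub>i\<^sub>j u\<^sub>i u\<^sub>j\<close>. Its unique solution is
  \<open>F\<^sub>i\<^sub>j u\<^sub>i u\<^sub>j = - s\<^sub>i s\<^sub>j\<close> with \<open>s\<^sub>i = u\<^sub>i w\<^sub>i\<close>, that is, \<open>u\<^sub>i u\<^sub>j (F\<^sub>i\<^sub>j + w\<^sub>i w\<^sub>j) = 0\<close>.\<close>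

lemma R2_at_critical_point:
  fixes x y z a b c M :: real
  defines "d \<equiv> det3 1 1 1 x y z" and "P \<equiv> (1 - x\<^sup>2) * (1 - y\<^sup>2) * (1 - z\<^sup>2)"
  assumes p: "x\<^sup>2 < 1" "y\<^sup>2 < 1" "z\<^sup>2 < 1" and d: "0 < d" and Pd: "P < d"
    and M: "M * ((1 + a\<^sup>2) * (1 + b\<^sup>2) * (1 + c\<^sup>2)) = d + adj_form 1 1 1 x y z a b c"
    and crit: "(1 - z\<^sup>2) * a + (y * z - x) * b + (x * z - y) * c = M * ((1 + b\<^sup>2) * (1 + c\<^sup>2) * a)"
      "(y * z - x) * a + (1 - y\<^sup>2) * b + (x * y - z) * c = M * ((1 + a\<^sup>2) * (1 + c\<^sup>2) * b)"
      "(x * z - y) * a + (x * y - z) * b + (1 - x\<^sup>2) * c = M * ((1 + a\<^sup>2) * (1 + b\<^sup>2) * c)"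
  shows "d * M \<le> P"
proof -
  define s1 s2 s3 where "s1 = a\<^sup>2 / (1 + a\<^sup>2)" and "s2 = b\<^sup>2 / (1 + b\<^sup>2)" and "s3 = c\<^sup>2 / (1 + c\<^sup>2)"
  define u1 u2 u3 where "u1 = a * (1 - s1)" and "u2 = b * (1 - s2)" and "u3 = c * (1 - s3)"
  define V where "V = M * ((1 + a\<^sup>2) * (1 + b\<^sup>2) * (1 + c\<^sup>2))"
  define S where "S = s1 + s2 + s3"
  have pos: "0 < 1 + t\<^sup>2" for t :: real by (rule add_pos_nonneg) simp_all
  have ne: "1 + a\<^sup>2 \<noteq> 0" "1 + b\<^sup>2 \<noteq> 0" "1 + c\<^sup>2 \<noteq> 0"
    using pos[of a] pos[of b] pos[of c] by simp_all
  have inv: "(1 + a\<^sup>2) * (1 - s1) = 1" "(1 + b\<^sup>2) * (1 - s2) = 1" "(1 + c\<^sup>2) * (1 - s3) = 1"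
    using ne by (auto simp: s1_def s2_def s3_def field_simps)
  have "a * u1 = a\<^sup>2 * (1 - s1)" "b * u2 = b\<^sup>2 * (1 - s2)" "c * u3 = c\<^sup>2 * (1 - s3)"
    by (simp_all add: u1_def u2_def u3_def power2_eq_square)
  hence au: "a * u1 = s1" "b * u2 = s2" "c * u3 = s3"
    using inv by (simp_all add: algebra_simps)
  have "u1\<^sup>2 = (a * u1) * (1 - s1)" "u2\<^sup>2 = (b * u2) * (1 - s2)" "u3\<^sup>2 = (c * u3) * (1 - s3)"
    by (simp_all add: u1_def u2_def u3_def power2_eq_square)
  hence uu: "u1\<^sup>2 = s1 * (1 - s1)" "u2\<^sup>2 = s2 * (1 - s2)" "u3\<^sup>2 = s3 * (1 - s3)"
    by (simp_all only: au)
  have "V * u1 = (1 + a\<^sup>2) * (1 - s1) * (M * ((1 + b\<^sup>2) * (1 + c\<^sup>2) * a))"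
    "V * u2 = (1 + b\<^sup>2) * (1 - s2) * (M * ((1 + a\<^sup>2) * (1 + c\<^sup>2) * b))"
    "V * u3 = (1 + c\<^sup>2) * (1 - s3) * (M * ((1 + a\<^sup>2) * (1 + b\<^sup>2) * c))"
    unfolding V_def u1_def u2_def u3_def by (simp_all only: ac_simps)
  hence U: "M * ((1 + b\<^sup>2) * (1 + c\<^sup>2) * a) = V * u1" "M * ((1 + a\<^sup>2) * (1 + c\<^sup>2) * b) = V * u2"
     "M * ((1 + a\<^sup>2) * (1 + b\<^sup>2) * c) = V * u3"
    by (simp_all only: inv mult_1)
  note crit' = crit[unfolded U]
  \<comment> \<open>The critical equations multiplied by the rows of the correlation matrix.\<close>
  have l1: "d * a = V * (u1 + x * u2 + y * u3)"
  proof -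
    have "d * a = ((1 - z\<^sup>2) * a + (y * z - x) * b + (x * z - y) * c)
        + x * ((y * z - x) * a + (1 - y\<^sup>2) * b + (x * y - z) * c)
        + y * ((x * z - y) * a + (x * y - z) * b + (1 - x\<^sup>2) * c)"
      unfolding d_def det3_def by (simp add: power2_eq_square algebra_simps)
    thus ?thesis unfolding crit' by (simp add: algebra_simps)
  qed
  have l2: "d * b = V * (x * u1 + u2 + z * u3)"
  proof -
    have "d * b = x * ((1 - z\<^sup>2) * a + (y * z - x) * b + (x * z - y) * c)
        + ((y * z - x) * a + (1 - y\<^sup>2) * b + (x * y - z) * c)
        + z * ((x * z - y) * a + (x * y - z) * b + (1 - x\<^sup>2) * c)"
      unfolding d_def det3_def by (simp add: power2_eq_square algebra_simps)
    thus ?thesis unfolding crit' by (simp add: algebra_simps)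
  qed
  have l3: "d * c = V * (y * u1 + z * u2 + u3)"
  proof -
    have "d * c = y * ((1 - z\<^sup>2) * a + (y * z - x) * b + (x * z - y) * c)
        + z * ((y * z - x) * a + (1 - y\<^sup>2) * b + (x * y - z) * c)
        + ((x * z - y) * a + (x * y - z) * b + (1 - x\<^sup>2) * c)"
      unfolding d_def det3_def by (simp add: power2_eq_square algebra_simps)
    thus ?thesis unfolding crit' by (simp add: algebra_simps)
  qed
  have "adj_form 1 1 1 x y z a b c = a * ((1 - z\<^sup>2) * a + (y * z - x) * b + (x * z - y) * c)
        + b * ((y * z - x) * a + (1 - y\<^sup>2) * b + (x * y - z) * c)
        + c * ((x * z - y) * a + (x * y - z) * b + (1 - x\<^sup>2) * c)"
    unfolding adj_form_def by (simp add: power2_eq_square algebra_simps)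
  also have "\<dots> = V * (a * u1 + b * u2 + c * u3)"
    unfolding crit' by (simp add: algebra_simps)
  also have "\<dots> = V * S" by (simp only: au S_def)
  finally have dV: "d = V * (1 - S)" using M unfolding V_def[symmetric] by (simp add: algebra_simps)
  have V0: "V \<noteq> 0" using d dV by auto
  have e1: "(1 - S) * a = u1 + x * u2 + y * u3" "(1 - S) * b = x * u1 + u2 + z * u3"
    "(1 - S) * c = y * u1 + z * u2 + u3"
    using l1 l2 l3 V0 unfolding dV by (simp_all add: mult.assoc)
  have n1: "x * (u1 * u2) + y * (u1 * u3) = - s1 * s2 - s1 * s3"
  proof -
    have "(1 - S) * (a * u1) = u1 * (u1 + x * u2 + y * u3)"
      using e1(1) by (metis mult.assoc mult.commute)
    hence "(1 - S) * s1 = u1\<^sup>2 + (x * (u1 * u2) + y * (u1 * u3))"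
      unfolding au by (simp add: power2_eq_square algebra_simps)
    thus ?thesis unfolding uu S_def by (simp add: algebra_simps)
  qed
  have n2: "x * (u1 * u2) + z * (u2 * u3) = - s1 * s2 - s2 * s3"
  proof -
    have "(1 - S) * (b * u2) = u2 * (x * u1 + u2 + z * u3)"
      using e1(2) by (metis mult.assoc mult.commute)
    hence "(1 - S) * s2 = u2\<^sup>2 + (x * (u1 * u2) + z * (u2 * u3))"
      unfolding au by (simp add: power2_eq_square algebra_simps)
    thus ?thesis unfolding uu S_def by (simp add: algebra_simps)
  qed
  have n3: "y * (u1 * u3) + z * (u2 * u3) = - s1 * s3 - s2 * s3"
  proof -
    have "(1 - S) * (c * u3) = u3 * (y * u1 + z * u2 + u3)"
      using e1(3) by (metis mult.assoc mult.commute)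
    hence "(1 - S) * s3 = u3\<^sup>2 + (y * (u1 * u3) + z * (u2 * u3))"
      unfolding au by (simp add: power2_eq_square algebra_simps)
    thus ?thesis unfolding uu S_def by (simp add: algebra_simps)
  qed
  have "x * (u1 * u2) = - s1 * s2" "y * (u1 * u3) = - s1 * s3" "z * (u2 * u3) = - s2 * s3"
    using n1 n2 n3 by linarith+
  hence "(u1 * u2) * (x + a * b) = 0" "(u1 * u3) * (y + a * c) = 0" "(u2 * u3) * (z + b * c) = 0"
    unfolding au[symmetric] by (simp_all add: algebra_simps)
  moreover have u0: "u1 = 0 \<longleftrightarrow> a = 0" "u2 = 0 \<longleftrightarrow> b = 0" "u3 = 0 \<longleftrightarrow> c = 0"
    using inv by (auto simp: u1_def u2_def u3_def)
  ultimately have E: "a = 0 \<or> b = 0 \<or> x = - (a * b)" "a = 0 \<or> c = 0 \<or> y = - (a * c)"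
     "b = 0 \<or> c = 0 \<or> z = - (b * c)" unfolding eq_neg_iff_add_eq_0 mult_eq_0_iff by blast+
  have nz: "0 < x * y * z"
    using prod_ge_det3_if_nonpos[of x y z] p Pd unfolding P_def d_def by force
  have minors: "d * (1 - x\<^sup>2) \<le> P" "d * (1 - y\<^sup>2) \<le> P" "d * (1 - z\<^sup>2) \<le> P"
    unfolding d_def P_def using p by (intro det3_times_minor_le_prod; simp)+
  hence minor_le: "1 - x\<^sup>2 \<le> P / d" "1 - y\<^sup>2 \<le> P / d" "1 - z\<^sup>2 \<le> P / d"
    using d by (simp_all add: pos_le_divide_eq mult.commute)
  have final: "d * M \<le> P" if "M * T \<le> P / d * T" "0 < T" for T
    using that d by (simp add: field_simps)
  \<comment> \<open>With a single nonzero coordinate, an off-diagonal entry vanishes, which \<open>0 < x y z\<close> excludes.\<close>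
  consider "a \<noteq> 0" "b \<noteq> 0" "c \<noteq> 0" | "a \<noteq> 0" "b = 0" "c = 0" | "b \<noteq> 0" "a = 0" "c = 0"
    | "c \<noteq> 0" "a = 0" "b = 0" | "a = 0" "b = 0" "c = 0"
    | "a \<noteq> 0" "b \<noteq> 0" "c = 0" | "a \<noteq> 0" "c \<noteq> 0" "b = 0" | "b \<noteq> 0" "c \<noteq> 0" "a = 0" by blast
  thus ?thesis
  proof cases
    case 1
    hence "x = - (a * b)" "y = - (a * c)" "z = - (b * c)" using E by auto
    hence "x * y * z = - (a * b * c)\<^sup>2" by (simp add: power2_eq_square)
    hence False using nz by (metis neg_0_less_iff_less not_less zero_le_power2)
    thus ?thesis ..
  next
    case 2
    hence "x * u1 = 0" using e1(2) u0 by simp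
    thus ?thesis using 2 u0 nz by simp
  next
    case 3
    hence "x * u2 = 0" using e1(1) u0 by simp
    thus ?thesis using 3 u0 nz by simp
  next
    case 4
    hence "y * u3 = 0" using e1(1) u0 by simp
    thus ?thesis using 4 u0 nz by simp
  next
    case 5
    hence "M = d" using M by (simp add: adj_form_def)
    moreover have "d \<le> 1 - x\<^sup>2" using det3_le_minor[of x y z] p by (simp add: d_def)
    ultimately show ?thesis using minor_le(1) by (intro final[of 1]) auto
  next
    case 6
    hence "x = - (a * b)" using E by simp
    hence "M * ((1 + a\<^sup>2) * (1 + b\<^sup>2)) \<le> P / d * ((1 + a\<^sup>2) * (1 + b\<^sup>2))"
      using two_active_bound[of x a b y "P / d" z] M 6 p minor_le by (simp add: d_def)
    thus ?thesis by (rule final) (intro mult_pos_pos add_pos_nonneg, auto)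
  next
    case 7
    have sw: "det3 1 1 1 y x z + adj_form 1 1 1 y x z a c 0 = d + adj_form 1 1 1 x y z a 0 c"
      by (simp add: d_def det3_def adj_form_def algebra_simps)
    have e: "y = - (a * c)" using E 7 by simp
    have "M * ((1 + a\<^sup>2) * (1 + c\<^sup>2)) = d + adj_form 1 1 1 x y z a 0 c" using M 7 by simp
    also have "\<dots> \<le> P / d * ((1 + a\<^sup>2) * (1 + c\<^sup>2))"
      using two_active_bound[OF e less_imp_le[OF p(2)] minor_le(1) minor_le(3)] unfolding sw .
    finally show ?thesis by (rule final) (intro mult_pos_pos add_pos_nonneg, auto)
  next
    case 8
    have sw: "det3 1 1 1 z x y + adj_form 1 1 1 z x y b c 0 = d + adj_form 1 1 1 x y z 0 b c"
      by (simp add: d_def det3_def adj_form_def algebra_simps)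
    have e: "z = - (b * c)" using E 8 by simp
    have "M * ((1 + b\<^sup>2) * (1 + c\<^sup>2)) = d + adj_form 1 1 1 x y z 0 b c" using M 8 by simp
    also have "\<dots> \<le> P / d * ((1 + b\<^sup>2) * (1 + c\<^sup>2))"
      using two_active_bound[OF e less_imp_le[OF p(3)] minor_le(1) minor_le(2)] unfolding sw .
    finally show ?thesis by (rule final) (intro mult_pos_pos add_pos_nonneg, auto)
  qed
qed

text \<open>The normalised determinant on a face of the cube of angles, where the unit \<open>\<sigma>\<close> is the sine of
  the extreme angle; the remaining entry is split as its excess \<open>k\<close> over the Markov value \<open>m n\<close>.\<close>

lemma det3_unit_factor:
  fixes m n k \<sigma> :: real
  assumes \<sigma>: "\<sigma>\<^sup>2 = 1"
  shows "det3 1 1 1 (\<sigma> * m) (\<sigma> * n) (k + m * n) = (1 - m\<^sup>2) * (1 - n\<^sup>2) - k\<^sup>2"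
    and "det3 1 1 1 (m * \<sigma>) (k + m * n) (\<sigma> * n) = (1 - m\<^sup>2) * (1 - n\<^sup>2) - k\<^sup>2"
    and "det3 1 1 1 (k + m * n) (m * \<sigma>) (n * \<sigma>) = (1 - m\<^sup>2) * (1 - n\<^sup>2) - k\<^sup>2"
proof -
  have "(1 - m\<^sup>2) * (1 - n\<^sup>2) - k\<^sup>2
      = 1 + 2 * 1 * m * n * (k + m * n) - (k + m * n)\<^sup>2 - 1 * n\<^sup>2 - 1 * m\<^sup>2"
    by (simp add: power2_eq_square algebra_simps)
  hence e: "(1 - m\<^sup>2) * (1 - n\<^sup>2) - k\<^sup>2
      = 1 + 2 * \<sigma>\<^sup>2 * m * n * (k + m * n) - (k + m * n)\<^sup>2 - \<sigma>\<^sup>2 * n\<^sup>2 - \<sigma>\<^sup>2 * m\<^sup>2"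
    unfolding \<sigma> .
  show "det3 1 1 1 (\<sigma> * m) (\<sigma> * n) (k + m * n) = (1 - m\<^sup>2) * (1 - n\<^sup>2) - k\<^sup>2"
    "det3 1 1 1 (m * \<sigma>) (k + m * n) (\<sigma> * n) = (1 - m\<^sup>2) * (1 - n\<^sup>2) - k\<^sup>2"
    "det3 1 1 1 (k + m * n) (m * \<sigma>) (n * \<sigma>) = (1 - m\<^sup>2) * (1 - n\<^sup>2) - k\<^sup>2"
    unfolding e by (simp_all add: det3_def power2_eq_square algebra_simps)
qed

text \<open>The maximum in the remaining case \<open>P < d\<close> is taken over \<open>[-\<pi>/2, \<pi>/2]\<^sup>3\<close>
  with \<open>(a, b, c)\<close> the tangents of the angles. In these coordinates the normalised determinant stays continuous where a coordinate becomes infinite.\<close>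

lemma R2_normalised:
  fixes x y z a b c :: real
  defines "d \<equiv> det3 1 1 1 x y z" and "P \<equiv> (1 - x\<^sup>2) * (1 - y\<^sup>2) * (1 - z\<^sup>2)"
  assumes p: "x\<^sup>2 < 1" "y\<^sup>2 < 1" "z\<^sup>2 < 1" and d: "0 < d"
  shows "d * (d + adj_form 1 1 1 x y z a b c) \<le> P * ((1 + a\<^sup>2) * (1 + b\<^sup>2) * (1 + c\<^sup>2))"
proof (cases "P < d")
  case False
  have entry: "(x + a * b)\<^sup>2 \<le> (1 + a\<^sup>2) * (1 + b\<^sup>2)" if "x\<^sup>2 < 1" for x a b :: real
  proof -
    have "(1 + a\<^sup>2) * (1 + b\<^sup>2) - (x + a * b)\<^sup>2 = (1 - x\<^sup>2) * (1 + b\<^sup>2) + (a - x * b)\<^sup>2"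
      by (simp add: power2_eq_square algebra_simps)
    moreover have "\<dots> \<ge> 0" using that by simp
    ultimately show ?thesis by linarith
  qed
  have "d + adj_form 1 1 1 x y z a b c \<le> (1 + a\<^sup>2) * (1 + b\<^sup>2) * (1 + c\<^sup>2)"
    unfolding d_def det3_rank_one_update[symmetric]
    by (rule det3_le_diag) (use p in \<open>auto intro!: entry\<close>)
  hence "d * (d + adj_form 1 1 1 x y z a b c) \<le> d * ((1 + a\<^sup>2) * (1 + b\<^sup>2) * (1 + c\<^sup>2))"
    using d by simp
  also have "\<dots> \<le> P * ((1 + a\<^sup>2) * (1 + b\<^sup>2) * (1 + c\<^sup>2))"
    using False by (intro mult_right_mono) auto
  finally show ?thesis .
next
  case Pd: True
  define K where "K = {-(pi/2)..pi/2} \<times> {-(pi/2)..pi/2} \<times> {-(pi/2)..pi/2}"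
  define H where "H = (\<lambda>r s t. det3 1 1 1 (x * (cos r * cos s) + sin r * sin s)
      (y * (cos r * cos t) + sin r * sin t) (z * (cos s * cos t) + sin s * sin t))"
  have H_tan: "H r s t * ((1 + a\<^sup>2) * (1 + b\<^sup>2) * (1 + c\<^sup>2)) = d + adj_form 1 1 1 x y z a b c"
    if "sin r = a * cos r" "sin s = b * cos s" "sin t = c * cos t" for r s t a b c
  proof -
    have sq: "(cos r)\<^sup>2 * (1 + a\<^sup>2) = 1" "(cos s)\<^sup>2 * (1 + b\<^sup>2) = 1" "(cos t)\<^sup>2 * (1 + c\<^sup>2) = 1"
      using sin_cos_squared_add[of r] sin_cos_squared_add[of s] sin_cos_squared_add[of t]
      unfolding that by (simp_all add: algebra_simps power_mult_distrib)
    define A B C where "A = (cos r)\<^sup>2" and "B = (cos s)\<^sup>2" and "C = (cos t)\<^sup>2"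
    note sq' = sq[folded A_def B_def C_def]
    have "H r s t = 1 + 2 * (x + a * b) * (y + a * c) * (z + b * c) * (A * B * C)
        - B * C * (z + b * c)\<^sup>2 - A * C * (y + a * c)\<^sup>2 - A * B * (x + a * b)\<^sup>2"
      unfolding H_def det3_def that A_def B_def C_def by (simp add: power2_eq_square algebra_simps)
    also have "\<dots> = (A * (1 + a\<^sup>2)) * (B * (1 + b\<^sup>2)) * (C * (1 + c\<^sup>2))
        + 2 * (x + a * b) * (y + a * c) * (z + b * c) * (A * B * C)
        - (A * (1 + a\<^sup>2)) * B * C * (z + b * c)\<^sup>2 - (B * (1 + b\<^sup>2)) * A * C * (y + a * c)\<^sup>2
        - (C * (1 + c\<^sup>2)) * A * B * (x + a * b)\<^sup>2"
      unfolding sq' by simp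
    also have "\<dots> = (A * B * C) * det3 (1 + a\<^sup>2) (1 + b\<^sup>2) (1 + c\<^sup>2) (x + a * b) (y + a * c) (z + b * c)"
      unfolding det3_def by (simp add: algebra_simps)
    also have "\<dots> = (A * B * C) * (d + adj_form 1 1 1 x y z a b c)"
      unfolding det3_rank_one_update d_def ..
    finally have "H r s t * ((1 + a\<^sup>2) * (1 + b\<^sup>2) * (1 + c\<^sup>2))
        = (A * (1 + a\<^sup>2)) * (B * (1 + b\<^sup>2)) * (C * (1 + c\<^sup>2)) * (d + adj_form 1 1 1 x y z a b c)"
      by (simp only: ac_simps)
    thus ?thesis unfolding sq' by simp
  qed
  have "compact K" unfolding K_def by (intro compact_Times compact_Icc)
  moreover have "(0, 0, 0) \<in> K" by (simp add: K_def)
  moreover have "continuous_on K (\<lambda>t. H (fst t) (fst (snd t)) (snd (snd t)))"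
    unfolding H_def det3_def by (intro continuous_intros)
  ultimately obtain t where t: "t \<in> K"
    "\<And>s. s \<in> K \<Longrightarrow> H (fst s) (fst (snd s)) (snd (snd s)) \<le> H (fst t) (fst (snd t)) (snd (snd t))"
    using continuous_attains_sup[of K "\<lambda>t. H (fst t) (fst (snd t)) (snd (snd t))"]
    by (metis empty_iff)
  obtain t1 t2 t3 where t0: "t = (t1, t2, t3)" by (cases t) auto
  define M where "M = H t1 t2 t3"
  have max: "d + adj_form 1 1 1 x y z a b c \<le> M * ((1 + a\<^sup>2) * (1 + b\<^sup>2) * (1 + c\<^sup>2))" for a b c
  proof -
    have "(arctan a, arctan b, arctan c) \<in> K"
      using arctan_bounded[of a] arctan_bounded[of b] arctan_bounded[of c]
      by (auto simp: K_def less_imp_le)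
    hence "H (arctan a) (arctan b) (arctan c) \<le> M"
      using t(2)[of "(arctan a, arctan b, arctan c)"] by (simp add: t0 M_def)
    moreover have "sin (arctan a) = a * cos (arctan a)" for a
      by (simp add: sin_arctan cos_arctan)
    ultimately show ?thesis
      using H_tan[of "arctan a" a "arctan b" b "arctan c" c]
      by (metis add_nonneg_nonneg mult_nonneg_nonneg mult_right_mono zero_le_one zero_le_power2)
  qed
  have "d * M \<le> P"
  proof (cases "cos t1 = 0 \<or> cos t2 = 0 \<or> cos t3 = 0")
    case True
    have minors: "d * (1 - x\<^sup>2) \<le> P" "d * (1 - y\<^sup>2) \<le> P" "d * (1 - z\<^sup>2) \<le> P"
      unfolding d_def P_def using p by (intro det3_times_minor_le_prod; simp)+
    have cos_le: "(cos s)\<^sup>2 * (cos t)\<^sup>2 * w \<le> w" if "0 \<le> w" for s t w :: real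
    proof -
      have "(cos s)\<^sup>2 * (cos t)\<^sup>2 \<le> 1" by (intro mult_le_one) (auto simp: abs_square_le_1)
      thus ?thesis using that mult_right_mono[of "(cos s)\<^sup>2 * (cos t)\<^sup>2" 1 w] by simp
    qed
    have "M \<le> 1 - x\<^sup>2 \<or> M \<le> 1 - y\<^sup>2 \<or> M \<le> 1 - z\<^sup>2"
      using True
    proof (elim disjE)
      assume "cos t1 = 0"
      hence "(sin t1)\<^sup>2 = 1" "cos t1 = 0" using sin_cos_squared_add[of t1] by auto
      hence "M = det3 1 1 1 (sin t1 * sin t2) (sin t1 * sin t3) (z * (cos t2 * cos t3) + sin t2 * sin t3)"
        by (simp add: M_def H_def)
      also have "\<dots> = (1 - (sin t2)\<^sup>2) * (1 - (sin t3)\<^sup>2) - (z * (cos t2 * cos t3))\<^sup>2"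
        by (rule det3_unit_factor(1)) fact
      also have "\<dots> = (cos t2)\<^sup>2 * (cos t3)\<^sup>2 * (1 - z\<^sup>2)"
        unfolding cos_squared_eq[symmetric] by (simp add: power_mult_distrib algebra_simps)
      finally have "M = (cos t2)\<^sup>2 * (cos t3)\<^sup>2 * (1 - z\<^sup>2)" .
      thus ?thesis using cos_le p by simp
    next
      assume "cos t2 = 0"
      hence "(sin t2)\<^sup>2 = 1" "cos t2 = 0" using sin_cos_squared_add[of t2] by auto
      hence "M = det3 1 1 1 (sin t1 * sin t2) (y * (cos t1 * cos t3) + sin t1 * sin t3) (sin t2 * sin t3)"
        by (simp add: M_def H_def)
      also have "\<dots> = (1 - (sin t1)\<^sup>2) * (1 - (sin t3)\<^sup>2) - (y * (cos t1 * cos t3))\<^sup>2"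
        by (rule det3_unit_factor(2)) fact
      also have "\<dots> = (cos t1)\<^sup>2 * (cos t3)\<^sup>2 * (1 - y\<^sup>2)"
        unfolding cos_squared_eq[symmetric] by (simp add: power_mult_distrib algebra_simps)
      finally have "M = (cos t1)\<^sup>2 * (cos t3)\<^sup>2 * (1 - y\<^sup>2)" .
      thus ?thesis using cos_le p by simp
    next
      assume "cos t3 = 0"
      hence "(sin t3)\<^sup>2 = 1" "cos t3 = 0" using sin_cos_squared_add[of t3] by auto
      hence "M = det3 1 1 1 (x * (cos t1 * cos t2) + sin t1 * sin t2) (sin t1 * sin t3) (sin t2 * sin t3)"
        by (simp add: M_def H_def)
      also have "\<dots> = (1 - (sin t1)\<^sup>2) * (1 - (sin t2)\<^sup>2) - (x * (cos t1 * cos t2))\<^sup>2"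
        by (rule det3_unit_factor(3)) fact
      also have "\<dots> = (cos t1)\<^sup>2 * (cos t2)\<^sup>2 * (1 - x\<^sup>2)"
        unfolding cos_squared_eq[symmetric] by (simp add: power_mult_distrib algebra_simps)
      finally have "M = (cos t1)\<^sup>2 * (cos t2)\<^sup>2 * (1 - x\<^sup>2)" .
      thus ?thesis using cos_le p by simp
    qed
    thus ?thesis using minors d by (meson dual_order.trans less_imp_le mult_left_mono)
  next
    case False
    define a0 b0 c0 where "a0 = tan t1" and "b0 = tan t2" and "c0 = tan t3"
    have eq: "M * ((1 + a0\<^sup>2) * (1 + b0\<^sup>2) * (1 + c0\<^sup>2)) = d + adj_form 1 1 1 x y z a0 b0 c0"
      unfolding M_def using False
      by (intro H_tan) (auto simp: a0_def b0_def c0_def tan_def)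
    define G where "G = (\<lambda>a b c. M * ((1 + a\<^sup>2) * (1 + b\<^sup>2) * (1 + c\<^sup>2)) - (d + adj_form 1 1 1 x y z a b c))"
    have G0: "G a0 b0 c0 \<le> G a b c" for a b c
      using max[of a b c] eq by (simp add: G_def)
    have "M * ((1 + b0\<^sup>2) * (1 + c0\<^sup>2) * a0) = (1 - z\<^sup>2) * a0 + (y * z - x) * b0 + (x * z - y) * c0"
    proof -
      define k0 where "k0 = M * ((1 + b0\<^sup>2) * (1 + c0\<^sup>2)) - d - adj_form 1 1 1 x y z 0 b0 c0"
      define k1 where "k1 = - (2 * (y * z - x) * b0 + 2 * (x * z - y) * c0)"
      define k2 where "k2 = M * ((1 + b0\<^sup>2) * (1 + c0\<^sup>2)) - (1 - z\<^sup>2)"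
      have "G t b0 c0 = k0 + k1 * t + k2 * t\<^sup>2" for t
        unfolding G_def k0_def k1_def k2_def adj_form_def
        by (simp add: power2_eq_square algebra_simps)
      hence "k1 + 2 * k2 * a0 = 0"
        using G0 by (intro local_min_quadratic[of 1 a0 k0 k1 k2]) (simp, metis)
      thus ?thesis unfolding k1_def k2_def by (simp add: algebra_simps)
    qed
    moreover have "M * ((1 + a0\<^sup>2) * (1 + c0\<^sup>2) * b0) = (y * z - x) * a0 + (1 - y\<^sup>2) * b0 + (x * y - z) * c0"
    proof -
      define k0 where "k0 = M * ((1 + a0\<^sup>2) * (1 + c0\<^sup>2)) - d - adj_form 1 1 1 x y z a0 0 c0"
      define k1 where "k1 = - (2 * (y * z - x) * a0 + 2 * (x * y - z) * c0)"
      define k2 where "k2 = M * ((1 + a0\<^sup>2) * (1 + c0\<^sup>2)) - (1 - y\<^sup>2)"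
      have "G a0 t c0 = k0 + k1 * t + k2 * t\<^sup>2" for t
        unfolding G_def k0_def k1_def k2_def adj_form_def
        by (simp add: power2_eq_square algebra_simps)
      hence "k1 + 2 * k2 * b0 = 0"
        using G0 by (intro local_min_quadratic[of 1 b0 k0 k1 k2]) (simp, metis)
      thus ?thesis unfolding k1_def k2_def by (simp add: algebra_simps)
    qed
    moreover have "M * ((1 + a0\<^sup>2) * (1 + b0\<^sup>2) * c0) = (x * z - y) * a0 + (x * y - z) * b0 + (1 - x\<^sup>2) * c0"
    proof -
      define k0 where "k0 = M * ((1 + a0\<^sup>2) * (1 + b0\<^sup>2)) - d - adj_form 1 1 1 x y z a0 b0 0"
      define k1 where "k1 = - (2 * (x * z - y) * a0 + 2 * (x * y - z) * b0)"
      define k2 where "k2 = M * ((1 + a0\<^sup>2) * (1 + b0\<^sup>2)) - (1 - x\<^sup>2)"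
      have "G a0 b0 t = k0 + k1 * t + k2 * t\<^sup>2" for t
        unfolding G_def k0_def k1_def k2_def adj_form_def
        by (simp add: power2_eq_square algebra_simps)
      hence "k1 + 2 * k2 * c0 = 0"
        using G0 by (intro local_min_quadratic[of 1 c0 k0 k1 k2]) (simp, metis)
      thus ?thesis unfolding k1_def k2_def by (simp add: algebra_simps)
    qed
    ultimately show ?thesis
      using R2_at_critical_point[of x y z M a0 b0 c0] p d Pd eq
      unfolding d_def P_def by simp
  qed
  hence "d * M * ((1 + a\<^sup>2) * (1 + b\<^sup>2) * (1 + c\<^sup>2)) \<le> P * ((1 + a\<^sup>2) * (1 + b\<^sup>2) * (1 + c\<^sup>2))"
    by (intro mult_right_mono) auto
  moreover have "d * (d + adj_form 1 1 1 x y z a b c) \<le> d * (M * ((1 + a\<^sup>2) * (1 + b\<^sup>2) * (1 + c\<^sup>2)))"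
    using d by (intro mult_left_mono max) simp
  ultimately show ?thesis by (simp add: mult.assoc)
qed

section \<open>From correlation matrices to arbitrary entries\<close>

text \<open>Writing the entries as \<open>g\<^sub>i\<^sup>2\<close> on the diagonal and \<open>g\<^sub>i g\<^sub>j X\<close> off it, every minor splits off a
  power of the \<open>g\<^sub>i\<close>.\<close>

lemma det3_scale:
  "det3 (g\<^sup>2) (h\<^sup>2) (k\<^sup>2) (g * h * x) (g * k * y) (h * k * z) = (g * h * k)\<^sup>2 * det3 1 1 1 x y z"
  by (simp add: det3_def power2_eq_square algebra_simps)

lemma adj_form_scale:
  "adj_form (g\<^sup>2) (h\<^sup>2) (k\<^sup>2) (g * h * x) (g * k * y) (h * k * z) (f * g * a) (f * h * b) (f * k * c)
     = f\<^sup>2 * (g * h * k)\<^sup>2 * adj_form 1 1 1 x y z a b c"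
  by (simp add: adj_form_def power2_eq_square algebra_simps)

lemma minor_scale: "g\<^sup>2 * h\<^sup>2 - (g * h * x)\<^sup>2 = (g * h)\<^sup>2 * (1 - x\<^sup>2)" for g h x :: real
  by (simp add: power2_eq_square algebra_simps)

lemma R3_entries:
  fixes e u v w p q r x y z :: real
  defines "d \<equiv> det3 p q r x y z"
  defines "D \<equiv> e * d - adj_form p q r x y z u v w"
  assumes pos: "0 < e" "0 < p" "0 < q" "0 < r"
    and minors: "0 < p * q - x\<^sup>2" "0 < p * r - y\<^sup>2" "0 < q * r - z\<^sup>2" and d: "0 < d" and D: "0 < D"
  shows "D * (p * q - x\<^sup>2) * (p * r - y\<^sup>2) * (q * r - z\<^sup>2) * e\<^sup>2
    \<le> d * (e * p - u\<^sup>2) * (e * q - v\<^sup>2) * (e * r - w\<^sup>2) * p * q * r"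
proof -
  define f g h k where "f = sqrt e" and "g = sqrt p" and "h = sqrt q" and "k = sqrt r"
  have g0: "0 < f" "0 < g" "0 < h" "0 < k" using pos by (auto simp: f_def g_def h_def k_def)
  have sq: "e = f\<^sup>2" "p = g\<^sup>2" "q = h\<^sup>2" "r = k\<^sup>2" using pos by (auto simp: f_def g_def h_def k_def)
  obtain X Y Z where X: "x = g * h * X" "y = g * k * Y" "z = h * k * Z"
    using that[of "x / (g * h)" "y / (g * k)" "z / (h * k)"] g0 by simp
  obtain a b c where a: "u = f * g * a" "v = f * h * b" "w = f * k * c"
    using that[of "u / (f * g)" "v / (f * h)" "w / (f * k)"] g0 by simp
  define N where "N = (g * h * k)\<^sup>2"
  have N: "0 < N" using g0 by (simp add: N_def)
  define d' q' P' Q' where "d' = det3 1 1 1 X Y Z" and "q' = adj_form 1 1 1 X Y Z a b c"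
    and "P' = (1 - X\<^sup>2) * (1 - Y\<^sup>2) * (1 - Z\<^sup>2)" and "Q' = (1 - a\<^sup>2) * (1 - b\<^sup>2) * (1 - c\<^sup>2)"
  have dN: "d = N * d'" by (simp add: d_def sq X det3_scale N_def d'_def)
  have DN: "D = f\<^sup>2 * N * (d' - q')"
    unfolding D_def dN unfolding sq X a adj_form_scale N_def q'_def by (simp add: algebra_simps)
  have "0 < d'" using d N by (simp add: dN zero_less_mult_iff)
  moreover have "q' \<le> d'"
    using zero_less_mult_pos[of "f\<^sup>2 * N" "d' - q'"] D N g0 unfolding DN by simp
  moreover have "X\<^sup>2 < 1" "Y\<^sup>2 < 1" "Z\<^sup>2 < 1"
    using minors unfolding sq X minor_scale by (simp_all add: zero_less_mult_iff)
  ultimately have main: "P' * (d' - q') \<le> d' * Q'"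
    unfolding P'_def d'_def q'_def Q'_def by (intro R3_normalised) auto
  have "D * (p * q - x\<^sup>2) * (p * r - y\<^sup>2) * (q * r - z\<^sup>2) * e\<^sup>2 = f ^ 6 * N ^ 3 * (P' * (d' - q'))"
    unfolding DN unfolding sq X minor_scale by (simp add: P'_def N_def power_mult_distrib eval_nat_numeral)
  also have "\<dots> \<le> f ^ 6 * N ^ 3 * (d' * Q')"
    using main g0 N by (intro mult_left_mono) auto
  also have "\<dots> = d * (e * p - u\<^sup>2) * (e * q - v\<^sup>2) * (e * r - w\<^sup>2) * p * q * r"
    unfolding dN unfolding sq a minor_scale by (simp add: Q'_def N_def power_mult_distrib eval_nat_numeral)
  finally show ?thesis .
qed

lemma rank_one_update_bound:
  fixes p q r x y z a b c :: real
  defines "d \<equiv> det3 p q r x y z"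
  assumes pos: "0 < p" "0 < q" "0 < r"
    and minors: "0 < p * q - x\<^sup>2" "0 < p * r - y\<^sup>2" "0 < q * r - z\<^sup>2" and d: "0 < d"
  shows "d * (d + adj_form p q r x y z a b c) * (p * q * r)
    \<le> (p * q - x\<^sup>2) * (p * r - y\<^sup>2) * (q * r - z\<^sup>2) * ((p + a\<^sup>2) * (q + b\<^sup>2) * (r + c\<^sup>2))"
proof -
  define g h k where "g = sqrt p" and "h = sqrt q" and "k = sqrt r"
  have g0: "0 < g" "0 < h" "0 < k" using pos by (auto simp: g_def h_def k_def)
  have sq: "p = g\<^sup>2" "q = h\<^sup>2" "r = k\<^sup>2" using pos by (auto simp: g_def h_def k_def)
  obtain X Y Z where X: "x = g * h * X" "y = g * k * Y" "z = h * k * Z"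
    using that[of "x / (g * h)" "y / (g * k)" "z / (h * k)"] g0 by simp
  obtain A B C where a: "a = 1 * g * A" "b = 1 * h * B" "c = 1 * k * C"
    using that[of "a / g" "b / h" "c / k"] g0 by simp
  define N where "N = (g * h * k)\<^sup>2"
  have N: "0 < N" using g0 by (simp add: N_def)
  define d' q' P' Q' where "d' = det3 1 1 1 X Y Z" and "q' = adj_form 1 1 1 X Y Z A B C"
    and "P' = (1 - X\<^sup>2) * (1 - Y\<^sup>2) * (1 - Z\<^sup>2)" and "Q' = (1 + A\<^sup>2) * (1 + B\<^sup>2) * (1 + C\<^sup>2)"
  have dN: "d = N * d'" by (simp add: d_def sq X det3_scale N_def d'_def)
  have qN: "adj_form p q r x y z a b c = N * q'"
    unfolding sq X a adj_form_scale N_def q'_def by simp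
  have "0 < d'" using d N by (simp add: dN zero_less_mult_iff)
  moreover have "X\<^sup>2 < 1" "Y\<^sup>2 < 1" "Z\<^sup>2 < 1"
    using minors unfolding sq X minor_scale by (simp_all add: zero_less_mult_iff)
  ultimately have main: "d' * (d' + q') \<le> P' * Q'"
    unfolding P'_def d'_def q'_def Q'_def by (intro R2_normalised) auto
  have "d * (d + adj_form p q r x y z a b c) * (p * q * r) = N ^ 3 * (d' * (d' + q'))"
    unfolding dN qN unfolding sq by (simp add: N_def power_mult_distrib eval_nat_numeral algebra_simps)
  also have "\<dots> \<le> N ^ 3 * (P' * Q')"
    using main N by (intro mult_left_mono) auto
  also have "N ^ 3 * (P' * Q')
    = (p * q - x\<^sup>2) * (p * r - y\<^sup>2) * (q * r - z\<^sup>2) * ((p + a\<^sup>2) * (q + b\<^sup>2) * (r + c\<^sup>2))"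
  proof -
    have s: "g\<^sup>2 + (1 * g * A)\<^sup>2 = g\<^sup>2 * (1 + A\<^sup>2)" for g A :: real
      by (simp add: power_mult_distrib algebra_simps)
    show ?thesis
      unfolding sq X a minor_scale s by (simp add: P'_def Q'_def N_def power_mult_distrib eval_nat_numeral)
  qed
  finally show ?thesis .
qed

text \<open>The preceding inequality for \<open>F = adj(C)\<close> and the vector \<open>adj(C) t / \<surd>D\<close>
  with \<open>t = (u, v, w)\<close>. By Sherman--Morrison, the update of \<open>F\<close> is then a multiple of the inverse
  of the Schur complement \<open>C - tt\<^sup>T / e\<close>, so every determinant involved is a principal minor of the four by four matrix up to
  powers of \<open>d\<close> and \<open>D\<close>.\<close>

lemma R2_entries:
  fixes e u v w p q r x y z :: real
  defines "d \<equiv> det3 p q r x y z"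
  defines "D \<equiv> e * d - adj_form p q r x y z u v w"
  assumes pos: "0 < p" "0 < q" "0 < r"
    and minors: "0 < p * q - x\<^sup>2" "0 < p * r - y\<^sup>2" "0 < q * r - z\<^sup>2" and d: "0 < d" and D: "0 < D"
  shows "D\<^sup>2 * (p * q - x\<^sup>2) * (p * r - y\<^sup>2) * (q * r - z\<^sup>2) * e
    \<le> det3 e p q u v x * det3 e p r u w y * det3 e q r v w z * d * p * q * r"
proof -
  define f1 f2 f3 where "f1 = q * r - z\<^sup>2" and "f2 = p * r - y\<^sup>2" and "f3 = p * q - x\<^sup>2"
  define x' y' z' where "x' = y * z - r * x" and "y' = x * z - q * y" and "z' = x * y - p * z"
  define \<alpha> \<beta> \<gamma> where "\<alpha> = f1 * u + x' * v + y' * w" and "\<beta> = x' * u + f2 * v + z' * w"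
    and "\<gamma> = y' * u + z' * v + f3 * w"
  define \<delta> where "\<delta> = sqrt D"
  note defs = f1_def f2_def f3_def x'_def y'_def z'_def \<alpha>_def \<beta>_def \<gamma>_def
  have \<delta>: "0 < \<delta>" "\<delta>\<^sup>2 = D" using D by (auto simp: \<delta>_def)
  have f: "0 < f1" "0 < f2" "0 < f3" using minors by (auto simp: f1_def f2_def f3_def)
  have adj_minors: "f1 * f2 - x'\<^sup>2 = d * r" "f1 * f3 - y'\<^sup>2 = d * q" "f2 * f3 - z'\<^sup>2 = d * p"
    by (simp_all add: defs d_def det3_def power2_eq_square algebra_simps)
  have adj_det: "det3 f1 f2 f3 x' y' z' = d\<^sup>2"
    by (simp add: defs d_def det3_def power2_eq_square algebra_simps)
  have "adj_form f1 f2 f3 x' y' z' \<alpha> \<beta> \<gamma>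
    = d * (p * \<alpha>\<^sup>2 + q * \<beta>\<^sup>2 + r * \<gamma>\<^sup>2 + 2 * x * \<alpha> * \<beta> + 2 * y * \<alpha> * \<gamma> + 2 * z * \<beta> * \<gamma>)"
  proof -
    have "y' * z' - f3 * x' = d * x" "x' * z' - f2 * y' = d * y" "x' * y' - f1 * z' = d * z"
      by (simp_all add: defs d_def det3_def power2_eq_square algebra_simps)
    thus ?thesis unfolding adj_form_def adj_minors by (simp add: algebra_simps)
  qed
  also have "p * \<alpha>\<^sup>2 + q * \<beta>\<^sup>2 + r * \<gamma>\<^sup>2 + 2 * x * \<alpha> * \<beta> + 2 * y * \<alpha> * \<gamma> + 2 * z * \<beta> * \<gamma>
     = \<alpha> * (p * \<alpha> + x * \<beta> + y * \<gamma>) + \<beta> * (x * \<alpha> + q * \<beta> + z * \<gamma>) + \<gamma> * (y * \<alpha> + z * \<beta> + r * \<gamma>)"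
    by (simp add: power2_eq_square algebra_simps)
  also have "p * \<alpha> + x * \<beta> + y * \<gamma> = d * u"
    by (simp add: defs d_def det3_def power2_eq_square algebra_simps)
  also have "x * \<alpha> + q * \<beta> + z * \<gamma> = d * v"
    by (simp add: defs d_def det3_def power2_eq_square algebra_simps)
  also have "y * \<alpha> + z * \<beta> + r * \<gamma> = d * w"
    by (simp add: defs d_def det3_def power2_eq_square algebra_simps)
  also have "\<alpha> * (d * u) + \<beta> * (d * v) + \<gamma> * (d * w) = d * (e * d - D)"
    by (simp add: defs D_def adj_form_def power2_eq_square algebra_simps)
  finally have form: "adj_form f1 f2 f3 x' y' z' \<alpha> \<beta> \<gamma> = d * (d * (e * d - D))" .
  have "adj_form f1 f2 f3 x' y' z' (\<alpha> / \<delta>) (\<beta> / \<delta>) (\<gamma> / \<delta>) = adj_form f1 f2 f3 x' y' z' \<alpha> \<beta> \<gamma> / \<delta>\<^sup>2"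
    using \<delta>(1) by (simp add: adj_form_def field_simps power2_eq_square)
  also have "\<dots> = d * (d * (e * d - D)) / D" unfolding form \<delta>(2) ..
  finally have upd: "d\<^sup>2 + adj_form f1 f2 f3 x' y' z' (\<alpha> / \<delta>) (\<beta> / \<delta>) (\<gamma> / \<delta>) = d ^ 3 * e / D"
    using D by (simp add: field_simps eval_nat_numeral)
  have three: "D * f1 + \<alpha>\<^sup>2 = d * det3 e q r v w z" "D * f2 + \<beta>\<^sup>2 = d * det3 e p r u w y"
    "D * f3 + \<gamma>\<^sup>2 = d * det3 e p q u v x"
    by (simp_all add: defs D_def adj_form_def d_def det3_def power2_eq_square algebra_simps)
  have diag: "f1 + (\<alpha> / \<delta>)\<^sup>2 = d * det3 e q r v w z / D" "f2 + (\<beta> / \<delta>)\<^sup>2 = d * det3 e p r u w y / D"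
    "f3 + (\<gamma> / \<delta>)\<^sup>2 = d * det3 e p q u v x / D"
    unfolding three[symmetric] power_divide \<delta>(2) using D by (simp_all add: field_simps)
  have "d\<^sup>2 * (d ^ 3 * e / D) * (f1 * f2 * f3)
    \<le> d * r * (d * q) * (d * p)
      * (d * det3 e q r v w z / D * (d * det3 e p r u w y / D) * (d * det3 e p q u v x / D))"
    using rank_one_update_bound[of f1 f2 f3 x' y' z' "\<alpha> / \<delta>" "\<beta> / \<delta>" "\<gamma> / \<delta>"] f pos d
    unfolding adj_minors adj_det upd diag by simp
  hence "D ^ 3 * (d\<^sup>2 * (d ^ 3 * e / D) * (f1 * f2 * f3))
    \<le> D ^ 3 * (d * r * (d * q) * (d * p)
      * (d * det3 e q r v w z / D * (d * det3 e p r u w y / D) * (d * det3 e p q u v x / D)))"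
    using D by (intro mult_left_mono) auto
  also have "D ^ 3 * (d\<^sup>2 * (d ^ 3 * e / D) * (f1 * f2 * f3)) = d ^ 5 * (D\<^sup>2 * f3 * f2 * f1 * e)"
    using D by (simp add: eval_nat_numeral)
  also have "D ^ 3 * (d * r * (d * q) * (d * p)
      * (d * det3 e q r v w z / D * (d * det3 e p r u w y / D) * (d * det3 e p q u v x / D)))
    = d ^ 5 * (det3 e p q u v x * det3 e p r u w y * det3 e q r v w z * d * p * q * r)"
    using D by (simp add: eval_nat_numeral)
  finally show ?thesis using d by (simp add: f1_def f2_def f3_def)
qed

section \<open>Principal minors of four by four matrices\<close>

text \<open>The enumeration \<open>pick\<close> of an index set is increasing, so it agrees with the sorted list of its
  elements.\<close>

lemma principal_minor_eq_det_mat: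
  assumes A: "A \<in> carrier_mat n n"
    and m: "length xs = m"
    and xs: "sorted_wrt (<) xs" "set xs = {i. Suc i \<in> \<alpha>}" "\<And>i. i \<in> set xs \<Longrightarrow> i < n"
  shows "principal_minor A \<alpha>
           = det (mat m m (\<lambda>(i, j). A $$ (xs ! i, xs ! j)))"
proof -
  have dist: "distinct xs" using xs(1) by (simp add: strict_sorted_iff)
  have dims: "{i. i < n \<and> i \<in> set xs} = set xs" using xs(3) by auto
  have pick: "pick (set xs) k = xs ! k" if k: "k < length xs" for k
  proof -
    have "{a \<in> set xs. a < xs ! k} = (!) xs ` {..<k}"
    proof (intro equalityI subsetI)
      fix a assume a: "a \<in> {a \<in> set xs. a < xs ! k}"
      then obtain j where j: "j < length xs" "a = xs ! j" by (auto simp: in_set_conv_nth)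
      have "j < k"
      proof (rule ccontr)
        assume "\<not> j < k"
        hence "xs ! k \<le> xs ! j"
          using sorted_wrt_nth_less[OF xs(1), of k j] j(1) by (cases "j = k") auto
        thus False using a j by auto
      qed
      thus "a \<in> (!) xs ` {..<k}" using j by auto
    next
      fix a assume "a \<in> (!) xs ` {..<k}"
      thus "a \<in> {a \<in> set xs. a < xs ! k}"
        using k sorted_wrt_nth_less[OF xs(1)] by auto
    qed
    moreover have "inj_on ((!) xs) {..<k}"
      using dist k by (auto simp: inj_on_def nth_eq_iff_index_eq)
    ultimately have "card {a \<in> set xs. a < xs ! k} = k" by (simp add: card_image)
    thus ?thesis using pick_card_in_set[of "xs ! k" "set xs"] k by simp
  qed
  have "principal_submatrix A \<alpha> = mat (length xs) (length xs) (\<lambda>(i, j). A $$ (xs ! i, xs ! j))"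
    unfolding principal_submatrix_def submatrix_def xs(2)[symmetric]
    using A dims dist by (intro eq_matI) (auto simp: distinct_card pick)
  thus ?thesis by (simp add: principal_minor_def m)
qed

lemma det_mat_Suc:
  fixes f :: "nat \<times> nat \<Rightarrow> real"
  shows "det (mat (Suc n) (Suc n) f)
    = (\<Sum>j<Suc n. f (0, j) * ((-1) ^ j
        * det (mat n n (\<lambda>(i, k). f (Suc i, if k < j then k else Suc k)))))"
proof -
  have "mat_delete (mat (Suc n) (Suc n) f) 0 j
          = mat n n (\<lambda>(i, k). f (Suc i, if k < j then k else Suc k))" for j
    by (intro eq_matI) (auto simp: mat_delete_def)
  thus ?thesis
    by (subst laplace_expansion_row[of _ "Suc n" 0]) (auto simp: cofactor_def intro!: sum.cong)
qed

lemma det_mat_1: "det (mat (Suc 0) (Suc 0) f) = (f (0, 0) :: real)"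
  by (simp add: det_mat_Suc)

lemma det_mat_2: "det (mat 2 2 f) = (f (0, 0) * f (1, 1) - f (0, 1) * f (1, 0) :: real)"
  by (simp add: det_mat_Suc numeral_2_eq_2 algebra_simps)

lemma det_mat_3_sym:
  fixes f :: "nat \<times> nat \<Rightarrow> real"
  assumes "f (1, 0) = f (0, 1)" "f (2, 0) = f (0, 2)" "f (2, 1) = f (1, 2)"
  shows "det (mat 3 3 f) = det3 (f (0, 0)) (f (1, 1)) (f (2, 2)) (f (0, 1)) (f (0, 2)) (f (1, 2))"
  using assms
  by (simp add: det_mat_Suc eval_nat_numeral det3_def power2_eq_square algebra_simps)

lemma det_mat_4_sym:
  fixes f :: "nat \<times> nat \<Rightarrow> real"
  assumes "f (1, 0) = f (0, 1)" "f (2, 0) = f (0, 2)" "f (2, 1) = f (1, 2)"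
    "f (3, 0) = f (0, 3)" "f (3, 1) = f (1, 3)" "f (3, 2) = f (2, 3)"
  shows "det (mat 4 4 f)
    = f (0, 0) * det3 (f (1, 1)) (f (2, 2)) (f (3, 3)) (f (1, 2)) (f (1, 3)) (f (2, 3))
      - adj_form (f (1, 1)) (f (2, 2)) (f (3, 3)) (f (1, 2)) (f (1, 3)) (f (2, 3))
          (f (0, 1)) (f (0, 2)) (f (0, 3))"
  using assms
  by (simp add: det_mat_Suc eval_nat_numeral det3_def adj_form_def power2_eq_square algebra_simps)

lemma principal_minors_4:
  fixes A :: "real mat"
  assumes A: "A \<in> carrier_mat 4 4" and sym: "transpose_mat A = A"
  defines "a \<equiv> A $$ (0,0)" and "u \<equiv> A $$ (0,1)" and "v \<equiv> A $$ (0,2)" and "w \<equiv> A $$ (0,3)"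
    and "p \<equiv> A $$ (1,1)" and "q \<equiv> A $$ (2,2)" and "r \<equiv> A $$ (3,3)"
    and "x \<equiv> A $$ (1,2)" and "y \<equiv> A $$ (1,3)" and "z \<equiv> A $$ (2,3)"
  shows "principal_minor A {1} = a"
    "principal_minor A {2} = p"
    "principal_minor A {3} = q"
    "principal_minor A {4} = r"
    "principal_minor A {1,2} = a * p - u\<^sup>2"
    "principal_minor A {1,3} = a * q - v\<^sup>2"
    "principal_minor A {1,4} = a * r - w\<^sup>2"
    "principal_minor A {2,3} = p * q - x\<^sup>2"
    "principal_minor A {2,4} = p * r - y\<^sup>2"
    "principal_minor A {3,4} = q * r - z\<^sup>2"
    "principal_minor A {1,2,3} = det3 a p q u v x"
    "principal_minor A {1,2,4} = det3 a p r u w y"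
    "principal_minor A {1,3,4} = det3 a q r v w z"
    "principal_minor A {2,3,4} = det3 p q r x y z"
    "principal_minor A {1,2,3,4} = a * det3 p q r x y z - adj_form p q r x y z u v w"
proof -
  have s: "A $$ (i, j) = A $$ (j, i)" if "i < 4" "j < 4" for i j
    using that A sym by (metis carrier_matD index_transpose_mat(1))
  have s': "A $$ (1,0) = A $$ (0,1)" "A $$ (2,0) = A $$ (0,2)" "A $$ (3,0) = A $$ (0,3)"
     "A $$ (2,1) = A $$ (1,2)" "A $$ (3,1) = A $$ (1,3)" "A $$ (3,2) = A $$ (2,3)"
    by (simp_all add: s)
  note pm = principal_minor_eq_det_mat[OF A]
  note d = a_def u_def v_def w_def p_def q_def r_def x_def y_def z_def
  have one: "principal_minor A {Suc i} = A $$ (i, i)" if "i < 4" for i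
    by (subst pm[of "[i]" 1]) (use that in \<open>auto simp: det_mat_1\<close>)
  have two: "principal_minor A {Suc i, Suc j} = A $$ (i, i) * A $$ (j, j) - (A $$ (i, j))\<^sup>2"
    if "i < j" "j < 4" for i j
    by (subst pm[of "[i, j]" 2]) (use that s[of j i] in \<open>auto simp: det_mat_2 power2_eq_square\<close>)
  have three: "principal_minor A {Suc i, Suc j, Suc k}
      = det3 (A $$ (i, i)) (A $$ (j, j)) (A $$ (k, k)) (A $$ (i, j)) (A $$ (i, k)) (A $$ (j, k))"
    if "i < j" "j < k" "k < 4" for i j k
    by (subst pm[of "[i, j, k]" 3])
      (use that s[of j i] s[of k i] s[of k j] in \<open>auto simp: det_mat_3_sym\<close>)
  show "principal_minor A {1} = a" "principal_minor A {2} = p"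
    "principal_minor A {3} = q" "principal_minor A {4} = r"
    using one[of 0] one[of 1] one[of 2] one[of 3] by (simp_all add: d eval_nat_numeral)
  show "principal_minor A {1,2} = a * p - u\<^sup>2"
    "principal_minor A {1,3} = a * q - v\<^sup>2"
    "principal_minor A {1,4} = a * r - w\<^sup>2"
    "principal_minor A {2,3} = p * q - x\<^sup>2"
    "principal_minor A {2,4} = p * r - y\<^sup>2"
    "principal_minor A {3,4} = q * r - z\<^sup>2"
    using two[of 0 1] two[of 0 2] two[of 0 3] two[of 1 2] two[of 1 3] two[of 2 3]
    by (simp_all add: d eval_nat_numeral)
  show "principal_minor A {1,2,3} = det3 a p q u v x"
    "principal_minor A {1,2,4} = det3 a p r u w y"
    "principal_minor A {1,3,4} = det3 a q r v w z"
    "principal_minor A {2,3,4} = det3 p q r x y z"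
    using three[of 0 1 2] three[of 0 1 3] three[of 0 2 3] three[of 1 2 3]
    by (simp_all add: d eval_nat_numeral)
  show "principal_minor A {1,2,3,4} = a * det3 p q r x y z - adj_form p q r x y z u v w"
    by (subst pm[of "[0,1,2,3]" 4]) (auto simp: det_mat_4_sym[unfolded One_nat_def] s'[unfolded One_nat_def] d)
qed

lemma quad_form_4:
  fixes A :: "real mat"
  assumes "A \<in> carrier_mat 4 4" "positive_definite_mat A"
    and "x0 \<noteq> 0 \<or> x1 \<noteq> 0 \<or> x2 \<noteq> 0 \<or> x3 \<noteq> 0"
  shows "0 < x0 * (A $$ (0,0) * x0 + A $$ (0,1) * x1 + A $$ (0,2) * x2 + A $$ (0,3) * x3)
     + x1 * (A $$ (1,0) * x0 + A $$ (1,1) * x1 + A $$ (1,2) * x2 + A $$ (1,3) * x3)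
     + x2 * (A $$ (2,0) * x0 + A $$ (2,1) * x1 + A $$ (2,2) * x2 + A $$ (2,3) * x3)
     + x3 * (A $$ (3,0) * x0 + A $$ (3,1) * x1 + A $$ (3,2) * x2 + A $$ (3,3) * x3)"
proof -
  define v where "v = vec 4 (\<lambda>i. [x0, x1, x2, x3] ! i)"
  have v: "v \<in> carrier_vec 4" by (simp add: v_def)
  have "v \<noteq> 0\<^sub>v 4"
  proof
    assume "v = 0\<^sub>v 4"
    hence "v $ i = 0" if "i < 4" for i using that by simp
    from this[of 0] this[of 1] this[of 2] this[of 3] assms(3) show False
      by (auto simp: v_def eval_nat_numeral)
  qed
  hence "0 < v \<bullet> (A *\<^sub>v v)"
    using assms v unfolding positive_definite_mat_def by auto
  also have "v \<bullet> (A *\<^sub>v v) = (\<Sum>i<4. v $ i * (\<Sum>j<4. A $$ (i, j) * v $ j))"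
    using assms(1) v by (auto simp: scalar_prod_def atLeast0LessThan intro!: sum.cong)
  finally show ?thesis
    by (simp add: v_def eval_nat_numeral)
qed

text \<open>The test vectors are the last columns of the adjugates of principal blocks: on such a column
  the form takes as its value the determinant of the block times that of the block without its
  last row and column.\<close>

lemma pos_def_3_minors:
  fixes p q r x y z :: real
  assumes pd: "\<And>a b c. a \<noteq> 0 \<or> b \<noteq> 0 \<or> c \<noteq> 0 \<Longrightarrow>
    0 < a * (p * a + x * b + y * c) + b * (x * a + q * b + z * c) + c * (y * a + z * b + r * c)"
  shows "0 < p" "0 < q" "0 < r" "0 < p * q - x\<^sup>2" "0 < p * r - y\<^sup>2" "0 < q * r - z\<^sup>2"
    "0 < det3 p q r x y z"
proof -
  show p: "0 < p" and q: "0 < q" and "0 < r" using pd[of 1 0 0] pd[of 0 1 0] pd[of 0 0 1] by auto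
  have "0 < p * (p * q - x\<^sup>2)" "0 < p * (p * r - y\<^sup>2)" "0 < q * (q * r - z\<^sup>2)"
    using pd[of "- x" p 0] pd[of "- y" 0 p] pd[of 0 "- z" q] p q
    by (auto simp: power2_eq_square algebra_simps)
  thus m: "0 < p * q - x\<^sup>2" and "0 < p * r - y\<^sup>2" "0 < q * r - z\<^sup>2"
    using p q by (auto simp: zero_less_mult_iff)
  have "0 < (p * q - x\<^sup>2) * det3 p q r x y z"
    using pd[of "x * z - q * y" "x * y - p * z" "p * q - x\<^sup>2"] m
    by (auto simp: det3_def power2_eq_square algebra_simps)
  thus "0 < det3 p q r x y z" using m by (simp add: zero_less_mult_iff)
qed

text \<open>The test vector is, up to sign, the first column of the four by four adjugate.\<close>

lemma pos_def_4_det: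
  fixes e u v w p q r x y z :: real
  defines "d \<equiv> det3 p q r x y z"
  assumes pd: "\<And>s a b c. s \<noteq> 0 \<or> a \<noteq> 0 \<or> b \<noteq> 0 \<or> c \<noteq> 0 \<Longrightarrow>
    0 < s * (e * s + u * a + v * b + w * c) + a * (u * s + p * a + x * b + y * c)
      + b * (v * s + x * a + q * b + z * c) + c * (w * s + y * a + z * b + r * c)"
    and d: "0 < d"
  shows "0 < e * d - adj_form p q r x y z u v w"
proof -
  define a b c where "a = (q * r - z\<^sup>2) * u + (y * z - r * x) * v + (x * z - q * y) * w"
    and "b = (y * z - r * x) * u + (p * r - y\<^sup>2) * v + (x * y - p * z) * w"
    and "c = (x * z - q * y) * u + (x * y - p * z) * v + (p * q - x\<^sup>2) * w"
  have "p * a + x * b + y * c = d * u" "x * a + q * b + z * c = d * v" "y * a + z * b + r * c = d * w"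
    by (simp_all add: a_def b_def c_def d_def det3_def power2_eq_square algebra_simps)
  hence z: "- u * d + (p * a + x * b + y * c) = 0" "- v * d + (x * a + q * b + z * c) = 0"
    "- w * d + (y * a + z * b + r * c) = 0" by simp_all
  have "0 < (- d) * (e * (- d) + u * a + v * b + w * c)
      + a * (u * (- d) + p * a + x * b + y * c)
      + b * (v * (- d) + x * a + q * b + z * c) + c * (w * (- d) + y * a + z * b + r * c)"
    using pd[of "- d" a b c] d by simp
  also have "\<dots> = d * (e * d - (u * a + v * b + w * c))
      + a * (- u * d + (p * a + x * b + y * c)) + b * (- v * d + (x * a + q * b + z * c))
      + c * (- w * d + (y * a + z * b + r * c))"
    by (simp add: algebra_simps)
  also have "\<dots> = d * (e * d - (u * a + v * b + w * c))" unfolding z by simp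
  also have "u * a + v * b + w * c = adj_form p q r x y z u v w"
    by (simp add: a_def b_def c_def adj_form_def power2_eq_square algebra_simps)
  finally show ?thesis using d by (simp add: zero_less_mult_iff)
qed

theorem theorem1p1:
  fixes A :: "real mat"
  assumes "A \<in> carrier_mat 4 4"
    and "transpose_mat A = A"
    and "positive_definite_mat A"
  shows "R2 A \<le> 1 \<and> R3 A \<le> 1"
proof -
  define e u v w where "e = A $$ (0,0)" and "u = A $$ (0,1)" and "v = A $$ (0,2)" and "w = A $$ (0,3)"
  define p q r where "p = A $$ (1,1)" and "q = A $$ (2,2)" and "r = A $$ (3,3)"
  define x y z where "x = A $$ (1,2)" and "y = A $$ (1,3)" and "z = A $$ (2,3)"
  note defs = e_def u_def v_def w_def p_def q_def r_def x_def y_def z_def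
  note minors = principal_minors_4[OF assms(1,2), folded defs]
  have sym: "A $$ (j, i) = A $$ (i, j)" if "i < 4" "j < 4" for i j
    using that assms(1,2) by (metis carrier_matD index_transpose_mat(1))
  have pd: "0 < s * (e * s + u * a + v * b + w * c) + a * (u * s + p * a + x * b + y * c)
      + b * (v * s + x * a + q * b + z * c) + c * (w * s + y * a + z * b + r * c)"
    if "s \<noteq> 0 \<or> a \<noteq> 0 \<or> b \<noteq> 0 \<or> c \<noteq> 0" for s a b c
    using quad_form_4[OF assms(1,3) that] sym[of 0 1] sym[of 0 2] sym[of 0 3] sym[of 1 2]
      sym[of 1 3] sym[of 2 3]
    by (simp add: defs)
  have m123: "0 < e" "0 < det3 e p q u v x" "0 < e * p - u\<^sup>2" "0 < e * q - v\<^sup>2"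
    using pos_def_3_minors[of e u v p x q] pd[of _ _ _ 0] by simp_all
  have m124: "0 < det3 e p r u w y" "0 < e * r - w\<^sup>2"
    using pos_def_3_minors[of e u w p y r] pd[of _ _ 0 _] by simp_all
  have m134: "0 < det3 e q r v w z"
    using pos_def_3_minors[of e v w q z r] pd[of _ 0 _ _] by simp
  have m234: "0 < p" "0 < q" "0 < r" "0 < p * q - x\<^sup>2" "0 < p * r - y\<^sup>2" "0 < q * r - z\<^sup>2"
    "0 < det3 p q r x y z"
    using pos_def_3_minors[of p x y q z r] pd[of 0 _ _ _] by simp_all
  have D: "0 < e * det3 p q r x y z - adj_form p q r x y z u v w"
    using pos_def_4_det pd m234(7) by blast
  have "R2 A \<le> 1"
    using R2_entries[OF m234 D] m123 m124 m134 m234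
    unfolding R2_def Let_def minors by (subst divide_le_eq_1_pos) (auto intro!: mult_pos_pos)
  moreover have "R3 A \<le> 1"
    using R3_entries[OF m123(1) m234 D] m123 m124 m134 m234
    unfolding R3_def Let_def minors by (subst divide_le_eq_1_pos) (auto intro!: mult_pos_pos)
  ultimately show ?thesis by blast
qed

end
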